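(* Consider the random trial-based telegraph process with velocities $c>0$ and $-v<0$ and trial parameters $b,r>0$, $A\ge0$ described in the context. For $t>0$ and $-vt<x<ct$ put $$\tau_*=\tau_*(x,t)=\frac{vt+x}{c+v}.$$ Then the densities $$f_k(x,t\,|\,c)=\frac{\partial}{\partial x}\mathbb{P}\{S_t\le x,V_t=c,M_t=k\mid V_0=c\},\qquad b_k(x,t\,|\,c)=\frac{\partial}{\partial x}\mathbb{P}\{S_t\le x,V_t=-v,M_t=k\mid V_0=c\}$$ can be expressed, for $t>0$ and $-vt<x<ct$, as $$f_k(x,t\,|\,c)=\frac{1}{c+v}\sum_{j=0}^{k-2}\mathbb{P}\{N_{k-1}=j,Z_k=c\mid Z_0=c\}\,f_D^{(k-j-1)}(t-\tau_* )\int_{t-\tau_*}^{t}f_U^{(j+1)}(s-t+\tau_* )\,\overline{F}_{U_{j+2}}(t-s)\,ds,\qquad k\ge2,$$ and $$b_k(x,t\,|\,c)=\frac{1}{c+v}\Big\{\mathbb{P}\{N_{k-1}=k-1,Z_k=-v\mid Z_0=c\}\,f_U^{(k)}(\tau_* )\,\overline{F}_{D_1}(t-\tau_* )$$ $$\qquad+\mathbf{1}_{\{k\ge2\}}\sum_{j=0}^{k-2}\mathbb{P}\{N_{k-1}=j,Z_k=-v\mid Z_0=c\}\,f_U^{(j+1)}(\tau_* )\int_{\tau_*}^{t}f_D^{(k-j-1)}(s-\tau_* )\,\overline{F}_{D_{k-j}}(t-s)\,ds\Big\},\qquad k\ge1,$$ where, for $k\ge1$ and $0\le j\le k-1$, if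 $A=0$ (with $p=b/(b+r)$) $$\mathbb{P}\{N_{k-1}=j,Z_k=c\mid Z_0=c\}=\binom{k-1}{j}p^{j+1}(1-p)^{k-1-j},\qquad \mathbb{P}\{N_{k-1}=j,Z_k=-v\mid Z_0=c\}=\binom{k-1}{j}p^{j}(1-p)^{k-j},$$ and if $A>0$ $$\mathbb{P}\{N_{k-1}=j,Z_k=c\mid Z_0=c\}=\binom{k-1}{j}\frac{\left(\frac{b+A}{A}\right)_{j+1}\left(\frac rA\right)_{k-j-1}}{\left(\frac{b+A+r}{A}\right)_k},\qquad \mathbb{P}\{N_{k-1}=j,Z_k=-v\mid Z_0=c\}=\binom{k-1}{j}\frac{\left(\frac{b+A}{A}\right)_{j}\left(\frac rA\right)_{k-j}}{\left(\frac{b+A+r}{A}\right)_k}.$$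
   Context: Model. Fix $c,v>0$, $b,r>0$ and $A\ge 0$. Let $\{X_n;n\ge1\}$ be $\{0,1\}$-valued random variables with $\mathbb{P}\{X_1=1\}=\frac{b}{b+r}$ and, for $n\ge1$, $\mathbb{P}\{X_{n+1}=1\mid \sigma(X_1,\dots,X_n)\}=\frac{b+A\sum_{k=1}^nX_k}{b+r+An}$ (for $A=0$ these are i.i.d. Bernoulli trials; for $A>0$ they are the outcomes of a classical Pólya urn). Put $Z_n=c$ if $X_{n+1}=1$ and $Z_n=-v$ if $X_{n+1}=0$, $n\ge 0$. Let $\{U_k;k\ge1\}$ and $\{D_k;k\ge1\}$ be mutually independent sequences of non-negative, absolutely continuous, independent random variables (not necessarily identically distributed), the collection $\{U_k,D_k;k\ge1\}$ being independent of $\{X_n;n\ge1\}$. $U_k$ (resp. $D_k$) is the duration of the $k$-th period during which the particle has velocity $c$ (resp. $-v$): $T_0=0$ and, for $n\ge0$, with $j_n=X_1+\cdots+X_{n+1}$, $T_{n+1}=T_n+U_{j_n}$ if $X_{n+1}=1$ and $T_{n+1}=T_n+D_{n+1-j_n}$ if $X_{n+1}=0$. Let $M_t=\max\{i\ge1:T_i\le t\}$ (with $M_t=0$ if $T_1>t$); it is assumed that $T_n\to\infty$ almost surely, so that $M_t$ is finite. The velocity and position at time $t$ are $V_t=Z_{M_t}$ and $S_t=\int_0^tV_s\,ds$, so $S_0=0$ and $V_0=Z_0$. Notation. $N_0=0$ and $N_{k-1}=\sum_{i=1}^{k-1}\mathbf{1}_{\{Z_i=c\}}=\sum_{h=2}^{k}X_h$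 for $k\ge2$. $\overline{F}_{U_k},\overline{F}_{D_k}$ are the tail distribution functions of $U_k$, $D_k$ (i.e. $\overline F_{U_k}(t)=\mathbb{P}\{U_k>t\}$); $f_U^{(k)}$, $f_D^{(k)}$ are the probability densities of $U^{(k)}=U_1+\cdots+U_k$ and $D^{(k)}=D_1+\cdots+D_k$. $(\alpha)_0=1$, $(\alpha)_j=\alpha(\alpha+1)\cdots(\alpha+j-1)$ is the ascending factorial. The functions $f_k(\cdot,t\,|\,c)$ and $b_k(\cdot,t\,|\,c)$ are densities on the open interval $(-vt,ct)$; as usual, equalities between densities are understood for almost every $x$. *)

theory Defs
  imports "HOL-Probability.Probability"
begin

text \<open>
  Throughout, \<open>X\<close>, \<open>U\<close>, \<open>D\<close> are indexed from 1; the values at index 0 are never used.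
\<close>

definition vel :: "real \<Rightarrow> real \<Rightarrow> (nat \<Rightarrow> 'a \<Rightarrow> nat) \<Rightarrow> nat \<Rightarrow> 'a \<Rightarrow> real" where
  "vel c v X n \<omega> = (if X (n + 1) \<omega> = 1 then c else - v)"

primrec epoch ::
  "(nat \<Rightarrow> 'a \<Rightarrow> nat) \<Rightarrow> (nat \<Rightarrow> 'a \<Rightarrow> real) \<Rightarrow> (nat \<Rightarrow> 'a \<Rightarrow> real) \<Rightarrow> nat \<Rightarrow> 'a \<Rightarrow> real"
where
  "epoch X U D 0 \<omega> = 0"
| "epoch X U D (Suc n) \<omega> = epoch X U D n \<omega> +
     (let j = (\<Sum>i = 1..n + 1. X i \<omega>)
      in if X (n + 1) \<omega> = 1 then U j \<omega> else D (n + 1 - j) \<omega>)"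

text \<open>
  The set under \<open>Max\<close> is finite for almost every outcome, because the epochs tend to infinity
  almost surely; on the exceptional null event \<open>Max\<close> returns a fixed junk value.
\<close>

definition nchanges ::
  "(nat \<Rightarrow> 'a \<Rightarrow> nat) \<Rightarrow> (nat \<Rightarrow> 'a \<Rightarrow> real) \<Rightarrow> (nat \<Rightarrow> 'a \<Rightarrow> real) \<Rightarrow> real \<Rightarrow> 'a \<Rightarrow> nat"
where
  "nchanges X U D t \<omega> =
     (if epoch X U D 1 \<omega> > t then 0 else Max {i. 1 \<le> i \<and> epoch X U D i \<omega> \<le> t})"

definition velocity ::
  "real \<Rightarrow> real \<Rightarrow> (nat \<Rightarrow> 'a \<Rightarrow> nat) \<Rightarrow> (nat \<Rightarrow> 'a \<Rightarrow> real) \<Rightarrow> (nat \<Rightarrow> 'a \<Rightarrow> real) \<Rightarrow>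
   real \<Rightarrow> 'a \<Rightarrow> real"
where
  "velocity c v X U D t \<omega> = vel c v X (nchanges X U D t \<omega>) \<omega>"

definition position ::
  "real \<Rightarrow> real \<Rightarrow> (nat \<Rightarrow> 'a \<Rightarrow> nat) \<Rightarrow> (nat \<Rightarrow> 'a \<Rightarrow> real) \<Rightarrow> (nat \<Rightarrow> 'a \<Rightarrow> real) \<Rightarrow>
   real \<Rightarrow> 'a \<Rightarrow> real"
where
  "position c v X U D t \<omega> = (LBINT s:{0..t}. velocity c v X U D s \<omega>)"

definition nforward :: "real \<Rightarrow> real \<Rightarrow> (nat \<Rightarrow> 'a \<Rightarrow> nat) \<Rightarrow> nat \<Rightarrow> 'a \<Rightarrow> nat" where
  "nforward c v X n \<omega> = (\<Sum>i = 1..n. of_bool (vel c v X i \<omega> = c))"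

definition trial_history :: "'a measure \<Rightarrow> (nat \<Rightarrow> 'a \<Rightarrow> nat) \<Rightarrow> nat \<Rightarrow> 'a measure" where
  "trial_history M X n =
     sigma (space M) (\<Union>i\<in>{1..n}. {X i -` B \<inter> space M | B. True})"

definition tail :: "'a measure \<Rightarrow> ('a \<Rightarrow> real) \<Rightarrow> real \<Rightarrow> real" where
  "tail M Y t = \<P>(\<omega> in M. Y \<omega> > t)"

locale trial_telegraph = prob_space M
  for M :: "'a measure" +
  fixes c v b r A :: real
    and X :: "nat \<Rightarrow> 'a \<Rightarrow> nat"
    and U D :: "nat \<Rightarrow> 'a \<Rightarrow> real"
  assumes c_pos: "c > 0" and v_pos: "v > 0"
    and b_pos: "b > 0" and r_pos: "r > 0" and A_nonneg: "A \<ge> 0"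
    and X_measurable: "\<And>n. n \<ge> 1 \<Longrightarrow> X n \<in> measurable M (count_space UNIV)"
    and X_values: "\<And>n \<omega>. n \<ge> 1 \<Longrightarrow> \<omega> \<in> space M \<Longrightarrow> X n \<omega> \<in> {0, 1}"
    and X_first: "\<P>(\<omega> in M. X 1 \<omega> = 1) = b / (b + r)"
    and X_next: "\<And>n. n \<ge> 1 \<Longrightarrow>
      AE \<omega> in M. real_cond_exp M (trial_history M X n) (indicator {\<omega> \<in> space M. X (n + 1) \<omega> = 1}) \<omega>
        = (b + A * real (\<Sum>k = 1..n. X k \<omega>)) / (b + r + A * real n)"
    and U_nonneg: "\<And>k. k \<ge> 1 \<Longrightarrow> AE \<omega> in M. U k \<omega> \<ge> 0"
    and D_nonneg: "\<And>k. k \<ge> 1 \<Longrightarrow> AE \<omega> in M. D k \<omega> \<ge> 0"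
    and U_ac: "\<And>k. k \<ge> 1 \<Longrightarrow> absolutely_continuous lborel (distr M borel (U k))"
    and D_ac: "\<And>k. k \<ge> 1 \<Longrightarrow> absolutely_continuous lborel (distr M borel (D k))"
    and UD_indep: "indep_vars (\<lambda>_. borel) (case_sum U D) ({1..} <+> {1..})"
    and UD_X_indep: "indep_set
      (sets (vimage_algebra (space M) (\<lambda>\<omega>. \<lambda>i\<in>{1..} <+> {1..}. case_sum U D i \<omega>)
               (PiM ({1..} <+> {1..}) (\<lambda>_. borel))))
      (sets (vimage_algebra (space M) (\<lambda>\<omega>. \<lambda>n\<in>{1..}. X n \<omega>)
               (PiM {1..} (\<lambda>_. count_space UNIV))))"
    and epoch_at_top: "AE \<omega> in M. filterlim (\<lambda>n. epoch X U D n \<omega>) at_top sequentially"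

text \<open>
  \<open>cond_density_on M Y E C I f\<close>: on \<open>I\<close>, \<open>f\<close> is (a version of) the density
  \<open>\<partial>/\<partial>x P{Y \<le> x, E | C}\<close>. This comprises both that the derivative exists and equals \<open>f\<close> almost
  everywhere on \<open>I\<close>, and that \<open>f\<close> integrates to the conditional law of \<open>Y\<close> on \<open>E\<close>. The second part
  does not follow from the first, since the law might have a singular part.
\<close>

definition cond_density_on ::
  "'a measure \<Rightarrow> ('a \<Rightarrow> real) \<Rightarrow> ('a \<Rightarrow> bool) \<Rightarrow> ('a \<Rightarrow> bool) \<Rightarrow> real set \<Rightarrow> (real \<Rightarrow> real) \<Rightarrow> bool"
where
  "cond_density_on M Y E C I f \<longleftrightarrow>
     (AE x in lborel. x \<in> I \<longrightarrow>
        ((\<lambda>y. \<P>(\<omega> in M. (Y \<omega> \<le> y \<and> E \<omega>) \<bar> C \<omega>)) has_real_derivative f x) (at x)) \<and>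
     set_integrable lborel I f \<and>
     (\<forall>B \<in> sets borel. B \<subseteq> I \<longrightarrow>
        \<P>(\<omega> in M. (Y \<omega> \<in> B \<and> E \<omega>) \<bar> C \<omega>) = (LBINT x:B. f x))"

end

theory Submission
  imports Defs
begin

text \<open>
Write \<open>U\<^bsup>(m)\<^esup>\<close> and \<open>D\<^bsup>(m)\<^esup>\<close> for the sums of the first \<open>m\<close> durations of either kind. Fix the first
velocity to be \<open>c\<close>, a number \<open>k\<close> of completed periods and the number \<open>j\<close> of successes
among the trials \<open>2, \<dots>, k\<close>. By its \<open>k\<close>-th epoch the particle has then travelled forward for the time
\<open>U\<^bsup>(j+1)\<^esup>\<close> and backward for the time \<open>D\<^bsup>(k-j-1)\<^esup>\<close>. If it moves forward at time \<open>t\<close>, all its backward motion is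
over, so its position is \<open>c t - (c + v) D\<^bsup>(k-j-1)\<^esup>\<close>; and exactly \<open>k\<close> periods are over iff
\<open>D\<^bsup>(k-j-1)\<^esup> + U\<^bsup>(j+1)\<^esup> \<le> t < D\<^bsup>(k-j-1)\<^esup> + U\<^bsup>(j+1)\<^esup> + U\<^bsub>j+2\<^esub>\<close>. If it moves backward, the two kinds of periods
change roles and the position is \<open>(c + v) U\<^bsup>(j+1)\<^esup> - v t\<close> (\<open>forward_path_iff\<close>, \<open>backward_path_iff\<close>).

In both cases the position is an affine image of one block sum, and the event involves two further
independent blocks. Conditioning on the first block turns its density into a density for the position,
with the probability that \<open>t\<close> falls into the last period as a factor (\<open>affine_law_straddle\<close>); that
factor is the convolution integral in the formulas (\<open>prob_straddle\<close>). The trials are independent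
of the durations, so the law of the position is the mixture of these laws over \<open>j\<close>, with the
conditional law of the trials as weights (\<open>straddle_mixture_density\<close>). The value \<open>j = k - 1\<close> is special:
no backward period is over. Then forward motion leads to the atom \<open>c t\<close>, which the open interval
excludes, and in backward motion the middle block is empty, so that the convolution degenerates to the
tail of \<open>D\<^sub>1\<close>.

The weights come from the recursion that the urn imposes on the number of successes after a first
success (\<open>prob_successes\<close>). A product over the factors \<open>b + A i\<close> and \<open>r + A i\<close> solves it for all
\<open>A \<ge> 0\<close> at once; powers and ascending factorials are the cases \<open>A = 0\<close> and \<open>A > 0\<close>.

To know the law on Borel subsets of the interval is not yet to know the derivative of the distribution
function. That an indefinite integral is differentiable almost everywhere is Lebesgue's theorem, proved
here on the line from the Vitali covering theorem (\<open>AE_has_real_derivative_integral\<close>).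
\<close>

section \<open>Differentiating an indefinite Lebesgue integral\<close>

lemma integrable_imp_set_integrable:
  fixes f :: "real \<Rightarrow> real"
  assumes "integrable lborel f" "S \<in> sets borel"
  shows "set_integrable lborel S f"
  unfolding set_integrable_def using assms by (intro integrable_mult_indicator) auto

text \<open>
The case of the differentiation theorem at points where the integrand vanishes. The measure with
density \<open>g\<close> gives no mass to \<open>A\<close>, so by outer regularity it gives little mass to some open \<open>V \<supseteq> A\<close>.
If the asserted bound fails at \<open>x \<in> A\<close>, then arbitrarily small balls around \<open>x\<close> inside \<open>V\<close> carry at
least \<open>e/2\<close> times their length; disjoint balls of this kind that cover almost all such \<open>x\<close> have
total length at most \<open>2/e\<close> times the mass of \<open>V\<close>.
\<close>

lemma AE_zero_density_ball:
  fixes g :: "real \<Rightarrow> real" and A :: "real set"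
  assumes g: "integrable lborel g" "\<And>x. 0 \<le> g x"
    and A: "A \<in> sets borel" and zero: "\<And>x. x \<in> A \<Longrightarrow> g x = 0" and e: "0 < e"
  shows "AE x in lborel. x \<in> A \<longrightarrow>
    (\<forall>\<^sub>F \<rho> in at_right 0. (LBINT y:ball x \<rho>. g y) \<le> e * \<rho>)"
proof -
  define \<nu> where "\<nu> = density lborel (\<lambda>x. ennreal (g x))"
  have [measurable]: "g \<in> borel_measurable borel" using g(1) by simp
  have sets_\<nu>[simp, measurable_cong]: "sets \<nu> = sets borel" by (simp add: \<nu>_def)
  have nu_eq: "emeasure \<nu> S = ennreal (LBINT y:S. g y)" if [measurable]: "S \<in> sets borel" for S
  proof -
    have "integrable lborel (\<lambda>x. indicator S x *\<^sub>R g x)"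
      using integrable_mult_indicator[of S lborel g] g(1) by simp
    then have "ennreal (LBINT y:S. g y) = (\<integral>\<^sup>+x. ennreal (indicator S x *\<^sub>R g x) \<partial>lborel)"
      unfolding set_lebesgue_integral_def using g(2) by (intro nn_integral_eq_integral[symmetric]) auto
    also have "\<dots> = emeasure \<nu> S"
      unfolding \<nu>_def by (subst emeasure_density) (auto intro!: nn_integral_cong split: split_indicator)
    finally show ?thesis by simp
  qed
  \<comment> \<open>The points of \<open>A\<close> where the bound fails for arbitrarily small radii.\<close>
  define N where "N = {x \<in> A. \<forall>d>0. \<exists>\<rho>. 0 < \<rho> \<and> \<rho> < d \<and> e * \<rho> < (LBINT y:ball x \<rho>. g y)}"
  have "negligible N"
    unfolding negligible_outer
  proof (intro allI impI)
    fix \<eta> :: real assume \<eta>: "\<eta> > 0"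
    have "emeasure \<nu> A = 0"
      unfolding \<nu>_def using A zero by (subst emeasure_density) (auto simp: nn_integral_0_iff_AE split: split_indicator)
    moreover have "emeasure \<nu> A = (INF V\<in>{V. A \<subseteq> V \<and> open V}. emeasure \<nu> V)"
      using A nu_eq[of UNIV] sets_eq_imp_space_eq[OF sets_\<nu>] by (intro outer_regular) auto
    ultimately have "(INF V\<in>{V. A \<subseteq> V \<and> open V}. emeasure \<nu> V) < ennreal (\<eta> * e / 2)"
      using \<eta> e by simp
    then obtain V where V: "A \<subseteq> V" "open V" "emeasure \<nu> V < ennreal (\<eta> * e / 2)"
      by (auto simp: Inf_less_iff)
    \<comment> \<open>A fine cover of \<open>N\<close> by balls that stay inside \<open>V\<close> and carry too much mass.\<close>
    define K where "K = {(x, \<rho>). x \<in> N \<and> 0 < \<rho> \<and> ball x \<rho> \<subseteq> V \<and> e * \<rho> < (LBINT y:ball x \<rho>. g y)}"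
    have "\<exists>i. i \<in> K \<and> x \<in> ball (fst i) (snd i) \<and> snd i < d" if x: "x \<in> N" "0 < d" for x d
    proof -
      have "x \<in> V" using x V(1) by (auto simp: N_def)
      then obtain d' where d': "d' > 0" "ball x d' \<subseteq> V" using openE[OF V(2)] by metis
      have "0 < min d d'" using x d' by simp
      then obtain \<rho> where \<rho>: "0 < \<rho>" "\<rho> < min d d'" "e * \<rho> < (LBINT y:ball x \<rho>. g y)"
        using x(1) unfolding N_def by blast
      then have "ball x \<rho> \<subseteq> V" using d'(2) subset_ball[of \<rho> d' x] by simp
      then show ?thesis using x \<rho> by (intro exI[of _ "(x, \<rho>)"]) (auto simp: K_def)
    qed
    from Vitali_covering_theorem_balls[of N K fst snd, OF this]
    obtain C where C: "countable C" "C \<subseteq> K"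
      "pairwise (\<lambda>i j. disjnt (ball (fst i) (snd i)) (ball (fst j) (snd j))) C"
      "negligible (N - (\<Union>i\<in>C. ball (fst i) (snd i)))" by blast
    define W where "W = (\<Union>i\<in>C. ball (fst i) (snd i))"
    have dj: "disjoint_family_on (\<lambda>i. ball (fst i) (snd i)) C"
      using C(3) by (auto simp: disjoint_family_on_def pairwise_def disjnt_def)
    have "open W" by (auto simp: W_def)
    then have Wb[measurable]: "W \<in> sets borel" by simp
    have "emeasure lborel W = (\<integral>\<^sup>+i. emeasure lborel (ball (fst i) (snd i)) \<partial>count_space C)"
      unfolding W_def using C dj by (intro emeasure_UN_countable) auto
    also have "\<dots> \<le> (\<integral>\<^sup>+i. ennreal (2 / e) * emeasure \<nu> (ball (fst i) (snd i)) \<partial>count_space C)"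
    proof (intro nn_integral_mono)
      fix i assume "i \<in> space (count_space C)"
      then have i: "0 < snd i" "e * snd i < (LBINT y:ball (fst i) (snd i). g y)"
        using C(2) by (auto simp: K_def)
      then have "2 * snd i \<le> 2 / e * (LBINT y:ball (fst i) (snd i). g y)"
        using e by (simp add: field_simps)
      moreover have "emeasure lborel (ball (fst i) (snd i)) = ennreal (2 * snd i)"
        using i by (simp add: ball_eq_greaterThanLessThan)
      ultimately show "emeasure lborel (ball (fst i) (snd i)) \<le> ennreal (2 / e) * emeasure \<nu> (ball (fst i) (snd i))"
        using e i by (simp add: nu_eq ennreal_mult'[symmetric] ennreal_leI)
    qed
    also have "\<dots> = ennreal (2 / e) * (\<integral>\<^sup>+i. emeasure \<nu> (ball (fst i) (snd i)) \<partial>count_space C)"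
      by (intro nn_integral_cmult) auto
    also have "\<dots> = ennreal (2 / e) * emeasure \<nu> W"
      unfolding W_def using C dj by (subst emeasure_UN_countable) auto
    also have "\<dots> \<le> ennreal (2 / e) * emeasure \<nu> V"
    proof -
      have "W \<subseteq> V" using C(2) unfolding W_def K_def by (intro UN_least) force
      then show ?thesis using V(2) by (intro mult_left_mono emeasure_mono) auto
    qed
    also have "\<dots> < ennreal (2 / e) * ennreal (\<eta> * e / 2)"
      using V(3) e by (intro ennreal_mult_strict_left_mono) auto
    also have "\<dots> = ennreal \<eta>"
      using e \<eta> by (simp add: ennreal_mult'[symmetric])
    finally have Wlt: "emeasure lborel W < ennreal \<eta>" .
    then have Wfin: "emeasure lborel W < \<infinity>" using less_trans by fastforce
    then have W: "W \<in> lmeasurable" by (auto simp: fmeasurable_def)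
    have null: "N - W \<in> null_sets lebesgue"
      using C(4) by (simp add: W_def negligible_iff_null_sets)
    let ?T = "W \<union> (N - W)"
    have "N - W \<in> lmeasurable" using null by (simp add: fmeasurableI_null_sets)
    then have "?T \<in> lmeasurable" using W by (intro fmeasurable.Un)
    moreover have "measure lebesgue ?T = measure lebesgue W"
      using W null by (intro measure_Un_null_set) auto
    moreover have "measure lebesgue W < \<eta>"
      using Wlt Wfin \<eta> by (simp add: measure_def enn2real_less_iff)
    ultimately show "\<exists>T. N \<subseteq> T \<and> T \<in> lmeasurable \<and> measure lebesgue T < \<eta>"
      by (intro exI[of _ ?T]) auto
  qed
  then have "AE x in lebesgue. x \<notin> N"
    by (simp add: negligible_iff_null_sets AE_not_in)
  then have "AE x in lborel. x \<notin> N" by (simp add: AE_completion_iff)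
  then show ?thesis
  proof eventually_elim
    case (elim x)
    show ?case
    proof
      assume "x \<in> A"
      with elim have "\<exists>d>0. \<forall>\<rho>. 0 < \<rho> \<longrightarrow> \<rho> < d \<longrightarrow> (LBINT y:ball x \<rho>. g y) \<le> e * \<rho>"
        by (simp add: N_def) (meson not_less)
      then obtain d where "d > 0" "\<And>\<rho>. 0 < \<rho> \<Longrightarrow> \<rho> < d \<Longrightarrow> (LBINT y:ball x \<rho>. g y) \<le> e * \<rho>"
        by blast
      then show "\<forall>\<^sub>F \<rho> in at_right 0. (LBINT y:ball x \<rho>. g y) \<le> e * \<rho>"
        unfolding eventually_at_right_field by (intro exI[of _ d]) auto
    qed
  qed
qed

text \<open>
Use \<open>f \<le> q + max 0 (f - q)\<close> for a rational \<open>q\<close> slightly above \<open>f x\<close>. The second summand vanishes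
at \<open>x\<close>, so its integral over short intervals at \<open>x\<close> is small relative to their length by \<open>AE_zero_density_ball\<close>. Only
countably many exceptional sets arise, since \<open>q\<close> is rational. Cutting off to bounded intervals makes
the second summand integrable.
\<close>

lemma AE_upper_slope:
  fixes f :: "real \<Rightarrow> real"
  assumes f: "integrable lborel f"
  shows "AE x in lborel. \<forall>e>0. \<exists>d>0. \<forall>u w. u \<le> x \<longrightarrow> x \<le> w \<longrightarrow> u < w \<longrightarrow> w - u < d \<longrightarrow>
    (LBINT y:{u<..w}. f y) \<le> (f x + e) * (w - u)"
proof -
  have [measurable]: "f \<in> borel_measurable borel" using f by simp
  define g where "g m q y = indicator {- real m<..<real m} y * max 0 (f y - q)" for m :: nat and q y :: real
  have g_int: "integrable lborel (g m q)" for m q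
  proof -
    have "integrable lborel (\<lambda>y. indicator {- real m<..<real m} y *\<^sub>R (max 0 (f y - q)))"
    proof (rule Bochner_Integration.integrable_bound)
      show "integrable lborel (\<lambda>y. \<bar>f y\<bar> + \<bar>q\<bar> * indicator {- real m<..<real m} y)"
        using f by (intro Bochner_Integration.integrable_add integrable_abs integrable_mult_right integrable_real_indicator) auto
    qed (auto split: split_indicator)
    then show ?thesis by (simp add: g_def[abs_def])
  qed
  have "AE x in lborel. x \<in> {x. g m q x = 0} \<longrightarrow>
      (\<forall>\<^sub>F \<rho> in at_right 0. (LBINT y:ball x \<rho>. g m q y) \<le> 1 / Suc n * \<rho>)" for m n :: nat and q :: real
  proof (rule AE_zero_density_ball[OF g_int])
    show "{x. g m q x = 0} \<in> sets borel" unfolding g_def by measurable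
  qed (auto simp: g_def)
  then have "AE x in lborel. \<forall>m n. \<forall>q\<in>\<rat>. x \<in> {x. g m q x = 0} \<longrightarrow>
      (\<forall>\<^sub>F \<rho> in at_right 0. (LBINT y:ball x \<rho>. g m q y) \<le> 1 / Suc n * \<rho>)"
    by (simp add: AE_all_countable AE_ball_countable countable_rat)
  then show ?thesis
  proof eventually_elim
    case (elim x)
    show ?case
    proof (intro allI impI)
      fix e :: real assume e: "0 < e"
      obtain q where q: "q \<in> \<rat>" "f x < q" "q < f x + e / 2"
        using Rats_dense_in_real[of "f x" "f x + e / 2"] e by auto
      obtain n where n: "1 / real (Suc n) < e / 4"
        using e nat_approx_posE[of "e / 4"] by auto
      obtain m :: nat where m: "\<bar>x\<bar> + 1 < m" using reals_Archimedean2 by blast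
      have "g m q x = 0" using q by (simp add: g_def)
      with elim q(1) have "\<forall>\<^sub>F \<rho> in at_right 0. (LBINT y:ball x \<rho>. g m q y) \<le> 1 / Suc n * \<rho>"
        by simp
      then obtain d where d: "d > 0" "\<And>\<rho>. 0 < \<rho> \<Longrightarrow> \<rho> < d \<Longrightarrow> (LBINT y:ball x \<rho>. g m q y) \<le> 1 / Suc n * \<rho>"
        unfolding eventually_at_right_field by auto
      show "\<exists>d>0. \<forall>u w. u \<le> x \<longrightarrow> x \<le> w \<longrightarrow> u < w \<longrightarrow> w - u < d \<longrightarrow>
        (LBINT y:{u<..w}. f y) \<le> (f x + e) * (w - u)"
      proof (intro exI[of _ "min (d / 2) (1 / 2)"] conjI allI impI)
        show "0 < min (d / 2) (1 / 2)" using d by simp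
        fix u w assume uw: "u \<le> x" "x \<le> w" "u < w" "w - u < min (d / 2) (1 / 2)"
        \<comment> \<open>The ball of this radius around \<open>x\<close> contains the interval, at the cost of a factor \<open>2\<close> that \<open>e / 4\<close> absorbs.\<close>
        define \<rho> where "\<rho> = 2 * (w - u)"
        have \<rho>: "0 < \<rho>" "\<rho> < d" "\<rho> < 1" using uw by (auto simp: \<rho>_def)
        have sub: "{u<..w} \<subseteq> ball x \<rho>" using uw by (auto simp: \<rho>_def dist_real_def)
        have subm: "ball x \<rho> \<subseteq> {- real m<..<real m}" using m \<rho> by (auto simp: dist_real_def)
        have fi: "set_integrable lborel {u<..w} f" and gi: "set_integrable lborel S (g m q)" if "S \<in> sets borel" for S
          using f g_int that by (auto intro!: integrable_imp_set_integrable)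
        have "(LBINT y:{u<..w}. f y) \<le> (LBINT y:{u<..w}. q + g m q y)"
        proof (rule set_integral_mono)
          show "set_integrable lborel {u<..w} (\<lambda>y. q + g m q y)"
            using uw by (intro set_integral_add gi) (auto simp: set_integrable_def)
          show "f y \<le> q + g m q y" if "y \<in> {u<..w}" for y
          proof -
            have "y \<in> {- real m<..<real m}" using that sub subm by blast
            then show ?thesis by (simp add: g_def)
          qed
        qed (use fi[of "{}"] in auto)
        also have "\<dots> = (LBINT y:{u<..w}. q) + (LBINT y:{u<..w}. g m q y)"
          using uw by (intro set_integral_add(2) gi) (auto simp: set_integrable_def)
        also have "(LBINT y:{u<..w}. q) = q * (w - u)"
          using uw by (simp add: set_lebesgue_integral_def)
        also have "(LBINT y:{u<..w}. g m q y) \<le> (LBINT y:ball x \<rho>. g m q y)"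
          unfolding set_lebesgue_integral_def
          by (intro integral_mono gi[unfolded set_integrable_def])
             (use sub in \<open>auto simp: g_def split: split_indicator\<close>)
        also have "\<dots> \<le> 1 / Suc n * \<rho>" using d(2) \<rho> by auto
        also have "\<dots> \<le> e / 4 * \<rho>" using n \<rho> by (intro mult_right_mono) auto
        also have "q * (w - u) + e / 4 * \<rho> \<le> (f x + e / 2) * (w - u) + e / 4 * \<rho>"
          using q uw by (intro add_right_mono mult_right_mono) auto
        also have "\<dots> = (f x + e) * (w - u)" by (simp add: \<rho>_def field_simps)
        finally show "(LBINT y:{u<..w}. f y) \<le> (f x + e) * (w - u)" by simp
      qed
    qed
  qed
qed

text \<open>
Lebesgue's differentiation theorem on the line: the upper bound on slopes for \<open>f\<close> and for \<open>- f\<close>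
bounds the difference quotients from both sides.
\<close>

lemma AE_has_real_derivative_integral:
  fixes f :: "real \<Rightarrow> real"
  assumes f: "integrable lborel f"
  shows "AE x in lborel. ((\<lambda>y. LBINT z:{..y}. f z) has_real_derivative f x) (at x)"
proof -
  define F where "F y = (LBINT z:{..y}. f z)" for y
  have fi: "set_integrable lborel S f" if "S \<in> sets borel" for S
    by (rule integrable_imp_set_integrable[OF f that])
  have F_diff: "F w - F u = (LBINT z:{u<..w}. f z)" if "u \<le> w" for u w
  proof -
    have "{..w} = {..u} \<union> {u<..w}" using that by auto
    moreover have "(LBINT z:{..u} \<union> {u<..w}. f z) = F u + (LBINT z:{u<..w}. f z)"
      unfolding F_def by (intro set_integral_Un fi) auto
    ultimately show ?thesis by (simp add: F_def)
  qed
  have "AE x in lborel. \<forall>e>0. \<exists>d>0. \<forall>u w. u \<le> x \<longrightarrow> x \<le> w \<longrightarrow> u < w \<longrightarrow> w - u < d \<longrightarrow>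
    (LBINT y:{u<..w}. - f y) \<le> (- f x + e) * (w - u)"
    using f by (intro AE_upper_slope) auto
  with AE_upper_slope[OF f] show ?thesis
    unfolding F_def[symmetric]
  proof eventually_elim
    case (elim x)
    show ?case
      unfolding has_field_derivative_iff
    proof (rule tendstoI)
      fix e :: real assume e: "0 < e"
      then have e2: "0 < e / 2" by simp
      from elim(1) e2 obtain d1 where d1: "d1 > 0"
        "\<And>u w. u \<le> x \<Longrightarrow> x \<le> w \<Longrightarrow> u < w \<Longrightarrow> w - u < d1 \<Longrightarrow> (LBINT y:{u<..w}. f y) \<le> (f x + e / 2) * (w - u)"
        by meson
      from elim(2) e2 obtain d2 where d2: "d2 > 0"
        "\<And>u w. u \<le> x \<Longrightarrow> x \<le> w \<Longrightarrow> u < w \<Longrightarrow> w - u < d2 \<Longrightarrow> (LBINT y:{u<..w}. - f y) \<le> (- f x + e / 2) * (w - u)"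
        by meson
      have bound: "\<bar>(F w - F u) / (w - u) - f x\<bar> < e"
        if "u \<le> x" "x \<le> w" "u < w" "w - u < min d1 d2" for u w
      proof -
        have "F w - F u \<le> (f x + e / 2) * (w - u)" "- (F w - F u) \<le> (- f x + e / 2) * (w - u)"
          using d1(2)[of u w] d2(2)[of u w] that F_diff[of u w] fi
          by (auto simp: set_lebesgue_integral_def)
        then have "(F w - F u) / (w - u) \<le> f x + e / 2" "(F w - F u) / (w - u) \<ge> f x - e / 2"
          using that by (auto simp: field_simps)
        then show ?thesis using e by linarith
      qed
      show "\<forall>\<^sub>F y in at x. dist ((F y - F x) / (y - x)) (f x) < e"
        unfolding eventually_at
      proof (intro exI[of _ "min d1 d2"] conjI ballI impI)
        show "0 < min d1 d2" using d1 d2 by simp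
        fix y assume y: "y \<noteq> x \<and> dist y x < min d1 d2"
        show "dist ((F y - F x) / (y - x)) (f x) < e"
        proof (cases "x < y")
          case True
          then show ?thesis using bound[of x y] y by (simp add: dist_real_def)
        next
          case False
          have "(F y - F x) / (y - x) = (F x - F y) / (x - y)"
            by (metis minus_diff_eq minus_divide_divide)
          then show ?thesis using bound[of y x] y False by (simp add: dist_real_def)
        qed
      qed
    qed
  qed
qed

text \<open>
It is enough to know the law of \<open>Y\<close> on Borel subsets of the interval: there the distribution function
is a constant, which collects the mass on the left of the interval, plus an indefinite integral.
\<close>

lemma (in prob_space) cond_density_onI:
  fixes l u :: real
  assumes Y[measurable]: "Y \<in> borel_measurable M"
    and E[measurable]: "Measurable.pred M E" and C[measurable]: "Measurable.pred M C"
    and f: "set_integrable lborel {l<..<u} f"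
    and law: "\<And>B. B \<in> sets borel \<Longrightarrow> B \<subseteq> {l<..<u} \<Longrightarrow>
      \<P>(\<omega> in M. (Y \<omega> \<in> B \<and> E \<omega>) \<bar> C \<omega>) = (LBINT x:B. f x)"
  shows "cond_density_on M Y E C {l<..<u} f"
  unfolding cond_density_on_def
proof (intro conjI allI ballI impI f law)
  define h where "h x = indicator {l<..<u} x * f x" for x
  have h: "integrable lborel h" using f by (simp add: h_def[abs_def] set_integrable_def)
  define a where "a = \<P>(\<omega> in M. (Y \<omega> \<le> l \<and> E \<omega>) \<bar> C \<omega>)"
  have split: "\<P>(\<omega> in M. (Y \<omega> \<le> y \<and> E \<omega>) \<bar> C \<omega>) = a + (LBINT z:{..y}. h z)" if y: "l < y" "y < u" for y
  proof -
    have "(LBINT z:{..y}. h z) = (LBINT z:{l<..y}. f z)"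
      unfolding set_lebesgue_integral_def h_def
      using y by (intro Bochner_Integration.integral_cong) (auto split: split_indicator)
    also have "\<dots> = \<P>(\<omega> in M. (Y \<omega> \<in> {l<..y} \<and> E \<omega>) \<bar> C \<omega>)"
      using y by (subst law) auto
    finally have 1: "(LBINT z:{..y}. h z) = \<dots>" .
    have "prob {\<omega> \<in> space M. (Y \<omega> \<le> y \<and> E \<omega>) \<and> C \<omega>}
      = prob ({\<omega> \<in> space M. (Y \<omega> \<le> l \<and> E \<omega>) \<and> C \<omega>} \<union> {\<omega> \<in> space M. (Y \<omega> \<in> {l<..y} \<and> E \<omega>) \<and> C \<omega>})"
      using y by (intro arg_cong[where f=prob]) auto
    also have "\<dots> = prob {\<omega> \<in> space M. (Y \<omega> \<le> l \<and> E \<omega>) \<and> C \<omega>} + prob {\<omega> \<in> space M. (Y \<omega> \<in> {l<..y} \<and> E \<omega>) \<and> C \<omega>}"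
      by (intro finite_measure_Union) auto
    finally show ?thesis
      unfolding 1 a_def cond_prob_def by (simp add: add_divide_distrib)
  qed
  from AE_has_real_derivative_integral[OF h]
  show "AE x in lborel. x \<in> {l<..<u} \<longrightarrow>
    ((\<lambda>y. \<P>(\<omega> in M. (Y \<omega> \<le> y \<and> E \<omega>) \<bar> C \<omega>)) has_real_derivative f x) (at x)"
  proof eventually_elim
    case (elim x)
    show ?case
    proof
      assume x: "x \<in> {l<..<u}"
      have "((\<lambda>y. a + (LBINT z:{..y}. h z)) has_real_derivative f x) (at x)"
        using elim x by (auto intro!: derivative_eq_intros simp: h_def)
      then show "((\<lambda>y. \<P>(\<omega> in M. (Y \<omega> \<le> y \<and> E \<omega>) \<bar> C \<omega>)) has_real_derivative f x) (at x)"
        by (rule has_field_derivative_transform_within_open[of _ _ _ "{l<..<u}"]) (use x split in auto)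
    qed
  qed
qed

section \<open>Conditioning on an independent variable with a density\<close>

lemma set_integral_shift:
  fixes F :: "real \<Rightarrow> real"
  shows "(LBINT q:{0..s}. F q) = (LBINT y:{a..a + s}. F (y - a))"
proof -
  have "(LBINT q:{0..s}. F q) = (\<integral>y. indicator {0..s} (- a + 1 * y) *\<^sub>R F (- a + 1 * y) \<partial>lborel)"
    unfolding set_lebesgue_integral_def
    by (subst lborel_integral_real_affine[where c=1 and t="- a"]) simp_all
  also have "\<dots> = (LBINT y:{a..a + s}. F (y - a))"
    unfolding set_lebesgue_integral_def
    by (intro Bochner_Integration.integral_cong) (auto split: split_indicator)
  finally show ?thesis .
qed

context prob_space
begin

text \<open>
The disintegration \<open>P((Y, W) \<in> S) = \<integral> g(y) P((y, W) \<in> S) dy\<close> for independent \<open>Y\<close> and \<open>W\<close>.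
Independence is expressed by the product form of the joint law, because \<open>indep_var\<close> makes the
two variables have the same type, whereas \<open>W\<close> may be a pair of reals.
\<close>

lemma prob_condition_on_density:
  fixes Y :: "'a \<Rightarrow> real" and g :: "real \<Rightarrow> real"
  assumes [measurable]: "random_variable borel Y" "random_variable N W"
    and ind: "distr M (borel \<Otimes>\<^sub>M N) (\<lambda>\<omega>. (Y \<omega>, W \<omega>)) = distr M borel Y \<Otimes>\<^sub>M distr M N W"
    and g: "distributed M lborel Y (\<lambda>y. ennreal (g y))" "\<And>y. 0 \<le> g y"
    and S[measurable]: "S \<in> sets (borel \<Otimes>\<^sub>M N)"
  shows "integrable lborel (\<lambda>y. g y * \<P>(\<omega> in M. (y, W \<omega>) \<in> S))" (is ?int)
    and "\<P>(\<omega> in M. (Y \<omega>, W \<omega>) \<in> S) = (\<integral>y. g y * \<P>(\<omega> in M. (y, W \<omega>) \<in> S) \<partial>lborel)" (is ?eq)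
proof -
  have [measurable]: "g \<in> borel_measurable borel"
    using distributed_real_measurable[OF g(2) g(1)] by simp
  interpret W: prob_space "distr M N W" by (rule prob_space_distr) simp
  have distY: "distr M borel Y = density lborel (\<lambda>y. ennreal (g y))"
  proof -
    have "distr M borel Y = distr M lborel Y" by (intro distr_cong) auto
    then show ?thesis using g(1) by (simp add: distributed_def)
  qed
  have h: "(\<lambda>y. emeasure (distr M N W) (Pair y -` S)) \<in> borel_measurable borel"
    by (rule W.measurable_emeasure_Pair) simp
  have sec: "emeasure (distr M N W) (Pair y -` S) = ennreal \<P>(\<omega> in M. (y, W \<omega>) \<in> S)" for y
    by (subst emeasure_distr) (auto simp: emeasure_eq_measure intro!: arg_cong[where f=prob])
  have [measurable]: "(\<lambda>y. \<P>(\<omega> in M. (y, W \<omega>) \<in> S)) \<in> borel_measurable borel"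
    using h unfolding sec by simp
  have "ennreal \<P>(\<omega> in M. (Y \<omega>, W \<omega>) \<in> S) = emeasure (distr M (borel \<Otimes>\<^sub>M N) (\<lambda>\<omega>. (Y \<omega>, W \<omega>))) S"
    by (subst emeasure_distr) (auto simp: emeasure_eq_measure intro!: arg_cong[where f=prob])
  also have "\<dots> = emeasure (distr M borel Y \<Otimes>\<^sub>M distr M N W) S"
    by (simp add: ind)
  also have "\<dots> = (\<integral>\<^sup>+y. emeasure (distr M N W) (Pair y -` S) \<partial>distr M borel Y)"
    by (rule W.emeasure_pair_measure_alt) simp
  also have "\<dots> = (\<integral>\<^sup>+y. ennreal (g y * \<P>(\<omega> in M. (y, W \<omega>) \<in> S)) \<partial>lborel)"
    unfolding distY sec by (subst nn_integral_density) (auto simp: ennreal_mult' g(2))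
  finally have eq: "ennreal \<P>(\<omega> in M. (Y \<omega>, W \<omega>) \<in> S) = \<dots>" .
  show int: ?int
    by (intro integrableI_nonneg) (use g(2) eq in \<open>auto simp: less_top[symmetric] eq[symmetric]\<close>)
  show ?eq
    using eq g(2) by (subst integral_eq_nn_integral) (auto simp: eq[symmetric])
qed

text \<open>
Read \<open>Q\<close> as the start of a period of length \<open>R\<close>; this is the probability that the period contains
the time \<open>s\<close>, found by conditioning on \<open>Q\<close>.
\<close>

lemma prob_straddle:
  fixes Q R :: "'a \<Rightarrow> real" and f :: "real \<Rightarrow> real"
  assumes ind: "indep_var borel Q borel R"
    and f: "distributed M lborel Q (\<lambda>y. ennreal (f y))" "\<And>y. 0 \<le> f y"
    and nonneg: "AE \<omega> in M. 0 \<le> Q \<omega>"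
  shows "\<P>(\<omega> in M. Q \<omega> \<le> s \<and> s < Q \<omega> + R \<omega>) = (LBINT q:{0..s}. f q * tail M R (s - q))"
proof -
  have [measurable]: "random_variable borel Q" "random_variable borel R"
    using ind by (auto dest: indep_var_rv1 indep_var_rv2)
  define S where "S = {(q, x). 0 \<le> q \<and> q \<le> s \<and> s < q + x}" 
  have S: "S \<in> sets (borel \<Otimes>\<^sub>M borel)"
  proof -
    have "{z \<in> space (borel \<Otimes>\<^sub>M borel). 0 \<le> fst z \<and> fst z \<le> s \<and> s < fst z + snd z} \<in> sets (borel \<Otimes>\<^sub>M borel)"
      by measurable
    then show ?thesis by (simp add: S_def space_pair_measure case_prod_beta')
  qed
  have "\<P>(\<omega> in M. Q \<omega> \<le> s \<and> s < Q \<omega> + R \<omega>) = \<P>(\<omega> in M. (Q \<omega>, R \<omega>) \<in> S)"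
    using nonneg by (intro prob_eq_AE) (auto simp: S_def)
  also have "\<dots> = (\<integral>q. f q * \<P>(\<omega> in M. (q, R \<omega>) \<in> S) \<partial>lborel)"
    using ind f S by (intro prob_condition_on_density(2)) (auto simp: indep_var_distribution_eq)
  also have "\<dots> = (LBINT q:{0..s}. f q * tail M R (s - q))"
    unfolding set_lebesgue_integral_def tail_def
    by (intro Bochner_Integration.integral_cong)
       (auto simp: S_def algebra_simps split: split_indicator intro!: arg_cong[where f=prob])
  finally show ?thesis .
qed

text \<open>
\<open>P\<close> fixes the position \<open>\<alpha> + \<beta> P\<close>, and \<open>Q\<close>, \<open>R\<close> decide whether the period that follows \<open>P + Q\<close>
contains \<open>t\<close>. Conditioning on \<open>P\<close> and substituting \<open>x = \<alpha> + \<beta> y\<close> gives the density of the position on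
that event.
\<close>

lemma affine_law_straddle:
  fixes P Q R :: "'a \<Rightarrow> real" and f :: "real \<Rightarrow> real" and \<alpha> \<beta> t :: real
  assumes rv: "random_variable borel P" "random_variable (borel \<Otimes>\<^sub>M borel) (\<lambda>\<omega>. (Q \<omega>, R \<omega>))"
    and ind: "distr M (borel \<Otimes>\<^sub>M (borel \<Otimes>\<^sub>M borel)) (\<lambda>\<omega>. (P \<omega>, Q \<omega>, R \<omega>))
      = distr M borel P \<Otimes>\<^sub>M distr M (borel \<Otimes>\<^sub>M borel) (\<lambda>\<omega>. (Q \<omega>, R \<omega>))"
    and f: "distributed M lborel P (\<lambda>y. ennreal (f y))" "\<And>y. 0 \<le> f y"
    and \<beta>: "\<beta> \<noteq> 0"
  defines "h \<equiv> (\<lambda>x. f ((x - \<alpha>) / \<beta>) / \<bar>\<beta>\<bar> *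
    \<P>(\<omega> in M. Q \<omega> \<le> t - (x - \<alpha>) / \<beta> \<and> t - (x - \<alpha>) / \<beta> < Q \<omega> + R \<omega>))"
  shows "integrable lborel h"
    and "B \<in> sets borel \<Longrightarrow>
      \<P>(\<omega> in M. \<alpha> + \<beta> * P \<omega> \<in> B \<and> P \<omega> + Q \<omega> \<le> t \<and> t < P \<omega> + Q \<omega> + R \<omega>) = (LBINT x:B. h x)"
proof -
  define S where "S B = {(y, q, w). \<alpha> + \<beta> * y \<in> B \<and> q \<le> t - y \<and> t - y < q + w}" for B :: "real set"
  have S: "S B \<in> sets (borel \<Otimes>\<^sub>M (borel \<Otimes>\<^sub>M borel))" if [measurable]: "B \<in> sets borel" for B
  proof -
    have "{z \<in> space (borel \<Otimes>\<^sub>M (borel \<Otimes>\<^sub>M borel)). \<alpha> + \<beta> * fst z \<in> B \<and>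
        fst (snd z) \<le> t - fst z \<and> t - fst z < fst (snd z) + snd (snd z)} \<in> sets (borel \<Otimes>\<^sub>M (borel \<Otimes>\<^sub>M borel))"
      by measurable
    then show ?thesis by (simp add: S_def space_pair_measure case_prod_beta')
  qed
  define k where "k B y = f y * \<P>(\<omega> in M. (y, Q \<omega>, R \<omega>) \<in> S B)" for B y
  note law = prob_condition_on_density[OF rv ind f S, folded k_def]
  \<comment> \<open>The inverse of \<open>y \<mapsto> \<alpha> + \<beta> y\<close>, in the form that affine substitution in the integral produces.\<close>
  have sub: "- \<alpha> / \<beta> + 1 / \<beta> * x = (x - \<alpha>) / \<beta>" for x
    by (simp add: diff_divide_distrib)
  have k_h: "\<bar>1 / \<beta>\<bar> * k B ((x - \<alpha>) / \<beta>) = indicator B x * h x" for B x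
    using \<beta> by (auto simp: k_def h_def S_def split: split_indicator)
  show "integrable lborel h"
  proof -
    have "integrable lborel (\<lambda>x. \<bar>1 / \<beta>\<bar> * k UNIV (- \<alpha> / \<beta> + 1 / \<beta> * x))"
      using \<beta> law(1)[of UNIV] by (intro integrable_mult_right lborel_integrable_real_affine) auto
    then show ?thesis unfolding sub k_h by simp
  qed
  show "\<P>(\<omega> in M. \<alpha> + \<beta> * P \<omega> \<in> B \<and> P \<omega> + Q \<omega> \<le> t \<and> t < P \<omega> + Q \<omega> + R \<omega>) = (LBINT x:B. h x)"
    if B: "B \<in> sets borel"
  proof -
    have "\<P>(\<omega> in M. \<alpha> + \<beta> * P \<omega> \<in> B \<and> P \<omega> + Q \<omega> \<le> t \<and> t < P \<omega> + Q \<omega> + R \<omega>)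
      = \<P>(\<omega> in M. (P \<omega>, Q \<omega>, R \<omega>) \<in> S B)"
      by (intro arg_cong[where f=prob] Collect_cong) (auto simp: S_def)
    also have "\<dots> = (\<integral>y. k B y \<partial>lborel)" by (rule law(2)[OF B])
    also have "\<dots> = (\<integral>x. \<bar>1 / \<beta>\<bar> * k B (- \<alpha> / \<beta> + 1 / \<beta> * x) \<partial>lborel)"
      using \<beta> by (subst lborel_integral_real_affine[where c="1 / \<beta>" and t="- \<alpha> / \<beta>"]) auto
    also have "\<dots> = (LBINT x:B. h x)"
      unfolding sub k_h set_lebesgue_integral_def by simp
    finally show ?thesis .
  qed
qed

lemma indep_vars_block_sums:
  fixes Z :: "'i \<Rightarrow> 'a \<Rightarrow> real"
  assumes ind: "indep_vars (\<lambda>_. borel) Z I"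
    and J: "J \<subseteq> I" "K \<subseteq> I" "L \<subseteq> I" and disj: "J \<inter> K = {}" "J \<inter> L = {}" "K \<inter> L = {}"
  shows "distr M (borel \<Otimes>\<^sub>M (borel \<Otimes>\<^sub>M borel)) (\<lambda>\<omega>. (\<Sum>i\<in>J. Z i \<omega>, \<Sum>i\<in>K. Z i \<omega>, \<Sum>i\<in>L. Z i \<omega>))
      = distr M borel (\<lambda>\<omega>. \<Sum>i\<in>J. Z i \<omega>) \<Otimes>\<^sub>M
        distr M (borel \<Otimes>\<^sub>M borel) (\<lambda>\<omega>. (\<Sum>i\<in>K. Z i \<omega>, \<Sum>i\<in>L. Z i \<omega>))"
    and "indep_var borel (\<lambda>\<omega>. \<Sum>i\<in>K. Z i \<omega>) borel (\<lambda>\<omega>. \<Sum>i\<in>L. Z i \<omega>)"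
proof -
  let ?X = "\<lambda>\<omega>. restrict (\<lambda>i. Z i \<omega>) J" and ?Y = "\<lambda>\<omega>. restrict (\<lambda>i. Z i \<omega>) (K \<union> L)"
  let ?f = "\<lambda>z :: 'i \<Rightarrow> real. \<Sum>i\<in>J. z i" and ?g = "\<lambda>z :: 'i \<Rightarrow> real. (\<Sum>i\<in>K. z i, \<Sum>i\<in>L. z i)"
  let ?A = "PiM J (\<lambda>_. borel :: real measure)" and ?B = "PiM (K \<union> L) (\<lambda>_. borel :: real measure)"
  have iv: "indep_var ?A ?X ?B ?Y"
    by (rule indep_var_restrict[OF ind]) (use J disj in auto)
  then have X[measurable]: "random_variable ?A ?X" and Y[measurable]: "random_variable ?B ?Y"
    by (auto dest: indep_var_rv1 indep_var_rv2)
  have f[measurable]: "?f \<in> borel_measurable ?A" by measurable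
  have g[measurable]: "?g \<in> measurable ?B (borel \<Otimes>\<^sub>M borel)" by measurable
  interpret Y: prob_space "distr (distr M ?B ?Y) (borel \<Otimes>\<^sub>M borel) ?g"
    by (intro prob_space.prob_space_distr prob_space_distr) auto
  have "distr (distr M ?A ?X) borel ?f \<Otimes>\<^sub>M distr (distr M ?B ?Y) (borel \<Otimes>\<^sub>M borel) ?g
    = distr (distr M ?A ?X \<Otimes>\<^sub>M distr M ?B ?Y) (borel \<Otimes>\<^sub>M (borel \<Otimes>\<^sub>M borel)) (\<lambda>(x, y). (?f x, ?g y))"
    by (rule pair_measure_distr) (auto intro: Y.sigma_finite_measure_axioms)
  also have "distr M ?A ?X \<Otimes>\<^sub>M distr M ?B ?Y = distr M (?A \<Otimes>\<^sub>M ?B) (\<lambda>\<omega>. (?X \<omega>, ?Y \<omega>))"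
    using iv by (simp add: indep_var_distribution_eq)
  finally show "distr M (borel \<Otimes>\<^sub>M (borel \<Otimes>\<^sub>M borel)) (\<lambda>\<omega>. (\<Sum>i\<in>J. Z i \<omega>, \<Sum>i\<in>K. Z i \<omega>, \<Sum>i\<in>L. Z i \<omega>))
      = distr M borel (\<lambda>\<omega>. \<Sum>i\<in>J. Z i \<omega>) \<Otimes>\<^sub>M
        distr M (borel \<Otimes>\<^sub>M borel) (\<lambda>\<omega>. (\<Sum>i\<in>K. Z i \<omega>, \<Sum>i\<in>L. Z i \<omega>))"
    unfolding distr_distr[OF f X] distr_distr[OF g Y]
    by (subst (asm) distr_distr) (auto simp: comp_def)
  have "indep_var (PiM K (\<lambda>_. borel)) (\<lambda>\<omega>. restrict (\<lambda>i. Z i \<omega>) K)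
      (PiM L (\<lambda>_. borel)) (\<lambda>\<omega>. restrict (\<lambda>i. Z i \<omega>) L)"
    by (rule indep_var_restrict[OF ind]) (use J disj in auto)
  then have "indep_var borel ((\<lambda>z. \<Sum>i\<in>K. z i) \<circ> (\<lambda>\<omega>. restrict (\<lambda>i. Z i \<omega>) K))
      borel ((\<lambda>z. \<Sum>i\<in>L. z i) \<circ> (\<lambda>\<omega>. restrict (\<lambda>i. Z i \<omega>) L))"
    by (rule indep_var_compose) measurable
  then show "indep_var borel (\<lambda>\<omega>. \<Sum>i\<in>K. Z i \<omega>) borel (\<lambda>\<omega>. \<Sum>i\<in>L. Z i \<omega>)"
    by (simp add: comp_def)
qed

end

section \<open>The law of the trials\<close>

text \<open>
The probability of \<open>m\<close> successes in the \<open>n\<close> trials that follow a first success: each of the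
\<open>n choose m\<close> orders has the same probability, in which the numerators collect
the urn's successive contents of either colour and the denominators its successive totals.
\<close>

definition urn_weight :: "real \<Rightarrow> real \<Rightarrow> real \<Rightarrow> nat \<Rightarrow> nat \<Rightarrow> real" where
  "urn_weight b r A n m = real (n choose m) *
     ((\<Prod>i<m. b + A * real (i + 1)) * (\<Prod>i<n - m. r + A * real i) / (\<Prod>i<n. b + r + A * real (i + 1)))"

lemma urn_weight_Suc_0:
  "urn_weight b r A (Suc n) 0 = urn_weight b r A n 0 * ((r + A * real n) / (b + r + A * real (n + 1)))"
  by (simp add: urn_weight_def)

lemma urn_weight_Suc_Suc:
  "urn_weight b r A (Suc n) (Suc m) =
     urn_weight b r A n (Suc m) * ((r + A * (real n - real m - 1)) / (b + r + A * real (n + 1))) +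
     urn_weight b r A n m * ((b + A * real (m + 1)) / (b + r + A * real (n + 1)))"
proof (cases "m < n")
  case True
  then have nm: "n - m = Suc (n - Suc m)" "real (n - Suc m) = real n - real m - 1" by auto
  define B where "B = (\<Prod>i<m. b + A * real (i + 1))"
  define R where "R = (\<Prod>i<n - Suc m. r + A * real i)"
  define T where "T = (\<Prod>i<n. b + r + A * real (i + 1))"
  define x where "x = r + A * (real n - real m - 1)"
  define y where "y = b + A * real (m + 1)"
  define d where "d = b + r + A * real (n + 1)"
  have 1: "urn_weight b r A (Suc n) (Suc m) = (real (n choose m) + real (n choose Suc m)) * (B * y * (R * x) / (T * d))"
    unfolding urn_weight_def B_def R_def T_def x_def y_def d_def diff_Suc_Suc nm(1) prod.lessThan_Suc nm(2) by simp
  have 2: "urn_weight b r A n (Suc m) = real (n choose Suc m) * (B * y * R / T)"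
    unfolding urn_weight_def B_def R_def T_def y_def prod.lessThan_Suc by simp
  have 3: "urn_weight b r A n m = real (n choose m) * (B * (R * x) / T)"
    unfolding urn_weight_def B_def R_def T_def x_def nm(1) prod.lessThan_Suc nm(2) by simp
  show ?thesis
    unfolding 1 2 3 x_def[symmetric] y_def[symmetric] d_def[symmetric]
    by (simp add: algebra_simps add_divide_distrib)
next
  case False
  then have "n < Suc m" "n - m = 0" by auto
  then show ?thesis by (simp add: urn_weight_def binomial_eq_0)
qed

lemma prod_affine_eq_pochhammer:
  fixes a A :: real
  assumes "A > 0"
  shows "(\<Prod>i<n. a + A * real i) = A ^ n * pochhammer (a / A) n"
proof -
  have "(\<Prod>i<n. a + A * real i) = (\<Prod>i<n. A * (a / A + real i))"
    using assms by (intro prod.cong) (auto simp: field_simps)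
  then show ?thesis by (simp add: prod.distrib pochhammer_prod atLeast0LessThan)
qed

context trial_telegraph
begin

abbreviation successes :: "nat \<Rightarrow> 'a \<Rightarrow> nat" where
  "successes n \<omega> \<equiv> \<Sum>i = 1..n. X i \<omega>"

lemma X_cases: "\<omega> \<in> space M \<Longrightarrow> X (Suc n) \<omega> = 0 \<or> X (Suc n) \<omega> = 1"
  using X_values[of "Suc n"] by simp

lemma X_pos_measurable [measurable]: "X (Suc n) \<in> measurable M (count_space UNIV)"
  using X_measurable[of "Suc n"] by simp

lemma successes_measurable [measurable]: "successes n \<in> measurable M (count_space UNIV)"
proof -
  have "(\<lambda>\<omega>. \<Sum>i<n. X (Suc i) \<omega>) \<in> measurable M (count_space UNIV)" by measurable
  also have "(\<lambda>\<omega>. \<Sum>i<n. X (Suc i) \<omega>) = successes n"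
    by (simp add: fun_eq_iff sum.atLeast1_atMost_eq)
  finally show ?thesis .
qed

lemma X_history_measurable:
  assumes "1 \<le> i" "i \<le> n"
  shows "X i \<in> measurable (trial_history M X n) (count_space UNIV)"
proof (rule measurableI)
  fix B :: "nat set"
  define G where "G = (\<Union>i\<in>{1..n}. {X i -` B \<inter> space M | B. True})"
  have G: "G \<subseteq> Pow (space M)" by (auto simp: G_def)
  have "X i -` B \<inter> space M \<in> G" using assms unfolding G_def by fastforce
  then show "X i -` B \<inter> space (trial_history M X n) \<in> sets (trial_history M X n)"
    unfolding trial_history_def G_def[symmetric] by (simp add: G space_measure_of_conv sigma_sets.Basic)
qed auto

lemma subalgebra_history: "subalgebra M (trial_history M X n)"
proof -
  define G where "G = (\<Union>i\<in>{1..n}. {X i -` B \<inter> space M | B. True})"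
  have G: "G \<subseteq> Pow (space M)" by (auto simp: G_def)
  have "G \<subseteq> sets M"
    using X_measurable by (auto simp: G_def intro: measurable_sets)
  then have "sigma_sets (space M) G \<subseteq> sets M"
    by (rule sets.sigma_sets_subset)
  then show ?thesis
    unfolding subalgebra_def trial_history_def G_def[symmetric] by (simp add: G space_measure_of_conv)
qed

text \<open>
Integrate the conditional probability of the next trial over an event of the trial history on
which the number of successes is constant.
\<close>

lemma prob_next_success:
  assumes n: "1 \<le> n"
  shows "\<P>(\<omega> in M. X 1 \<omega> = 1 \<and> successes n \<omega> = m \<and> X (Suc n) \<omega> = 1)
    = \<P>(\<omega> in M. X 1 \<omega> = 1 \<and> successes n \<omega> = m) * ((b + A * real m) / (b + r + A * real n))"
proof -
  define F where "F = trial_history M X n"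
  interpret sigma_finite_subalgebra M F
    by (intro finite_measure_subalgebra_is_sigma_finite)
       (auto simp: F_def finite_measure_subalgebra_def finite_measure_subalgebra_axioms_def
         finite_measure_axioms subalgebra_history)
  define H where "H = {\<omega> \<in> space M. X 1 \<omega> = 1 \<and> successes n \<omega> = m}"
  have sp: "space F = space M" using subalgebra_history by (simp add: F_def subalgebra_def)
  have H: "H \<in> sets F"
  proof -
    have [measurable]: "X 1 \<in> measurable F (count_space UNIV)"
      using X_history_measurable[of 1 n] n by (simp add: F_def)
    have [measurable]: "successes n \<in> measurable F (count_space UNIV)"
    proof -
      have "(\<lambda>\<omega>. \<Sum>i\<in>{..<n}. X (Suc i) \<omega>) \<in> measurable F (count_space UNIV)"
        using X_history_measurable[of "Suc _" n] unfolding F_def by (intro measurable_sum_nat) auto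
      then show ?thesis by (simp add: sum.atLeast1_atMost_eq)
    qed
    have "{\<omega> \<in> space F. X 1 \<omega> = 1 \<and> successes n \<omega> = m} \<in> sets F" by measurable
    then show ?thesis by (simp add: H_def sp)
  qed
  have [measurable]: "H \<in> sets M" using H subalgebra_history by (auto simp: F_def subalgebra_def)
  let ?E = "{\<omega> \<in> space M. X (n + 1) \<omega> = 1}"
  have [measurable]: "?E \<in> sets M" by simp
  have "prob (H \<inter> ?E) = (\<integral>\<omega>\<in>H. indicator ?E \<omega> \<partial>M)"
    by (simp add: set_lebesgue_integral_def flip: indicator_inter_arith)
  also have "\<dots> = (\<integral>\<omega>\<in>H. real_cond_exp M F (indicator ?E) \<omega> \<partial>M)"
    by (intro real_cond_exp_intA H integrable_real_indicator) (measurable, simp add: less_top[symmetric])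
  also have "\<dots> = (\<integral>\<omega>\<in>H. (b + A * real m) / (b + r + A * real n) \<partial>M)"
    unfolding set_lebesgue_integral_def
  proof (rule integral_cong_AE)
    show "AE \<omega> in M. indicator H \<omega> *\<^sub>R real_cond_exp M F (indicator ?E) \<omega>
        = indicator H \<omega> *\<^sub>R ((b + A * real m) / (b + r + A * real n))"
      using X_next[OF n] by eventually_elim (auto simp: F_def H_def split: split_indicator)
  qed auto
  also have "\<dots> = prob H * ((b + A * real m) / (b + r + A * real n))"
    by (simp add: set_lebesgue_integral_def)
  finally have "prob (H \<inter> ?E) = prob H * ((b + A * real m) / (b + r + A * real n))" .
  moreover have "H \<inter> ?E = {\<omega> \<in> space M. X 1 \<omega> = 1 \<and> successes n \<omega> = m \<and> X (Suc n) \<omega> = 1}"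
    by (auto simp: H_def)
  ultimately show ?thesis by (simp add: H_def)
qed

lemma prob_next_failure:
  assumes n: "1 \<le> n"
  shows "\<P>(\<omega> in M. X 1 \<omega> = 1 \<and> successes n \<omega> = m \<and> X (Suc n) \<omega> = 0)
    = \<P>(\<omega> in M. X 1 \<omega> = 1 \<and> successes n \<omega> = m) * ((r + A * (real n - real m)) / (b + r + A * real n))"
proof -
  let ?H = "{\<omega> \<in> space M. X 1 \<omega> = 1 \<and> successes n \<omega> = m}"
  let ?Hs = "{\<omega> \<in> space M. X 1 \<omega> = 1 \<and> successes n \<omega> = m \<and> X (Suc n) \<omega> = 1}"
  let ?Hf = "{\<omega> \<in> space M. X 1 \<omega> = 1 \<and> successes n \<omega> = m \<and> X (Suc n) \<omega> = 0}"
  have [measurable]: "X 1 \<in> measurable M (count_space UNIV)" using X_measurable by simp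
  have "?H = ?Hs \<union> ?Hf"
  proof (intro set_eqI iffI)
    fix \<omega> assume "\<omega> \<in> ?H"
    then show "\<omega> \<in> ?Hs \<union> ?Hf" using X_cases[of \<omega> n] by auto
  qed auto
  then have "prob ?H = prob (?Hs \<union> ?Hf)" by (simp only:)
  also have "\<dots> = prob ?Hs + prob ?Hf"
  proof (rule finite_measure_Union)
    show "?Hs \<in> events" "?Hf \<in> events" by measurable
  qed auto
  finally have "prob ?H = prob ?Hs + prob ?Hf" .
  then have "prob ?Hf = prob ?H - prob ?H * ((b + A * real m) / (b + r + A * real n))"
    using prob_next_success[OF n, of m] by linarith
  also have "\<dots> = prob ?H * (1 - (b + A * real m) / (b + r + A * real n))"
    by (simp add: right_diff_distrib)
  also have "1 - (b + A * real m) / (b + r + A * real n) = (r + A * (real n - real m)) / (b + r + A * real n)"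
  proof -
    have "0 < b + r + A * real n"
      using b_pos r_pos A_nonneg by (intro add_pos_nonneg) auto
    then show ?thesis by (simp add: field_simps)
  qed
  finally show ?thesis .
qed

text \<open>
After a first success the number of successes is a Markov chain, since the next conditional
probability depends on the past only through this number. Its one-step recursion is the one solved
by \<open>urn_weight\<close>.
\<close>

lemma prob_successes:
  "\<P>(\<omega> in M. X 1 \<omega> = 1 \<and> successes (Suc n) \<omega> = Suc m) = b / (b + r) * urn_weight b r A n m"
proof (induction n arbitrary: m)
  case 0
  show ?case
  proof (cases m)
    case 0
    then show ?thesis using X_first by (simp add: urn_weight_def)
  next
    case (Suc m')
    then have "{\<omega> \<in> space M. X 1 \<omega> = 1 \<and> successes (Suc 0) \<omega> = Suc m} = {}" by auto
    then have "\<P>(\<omega> in M. X 1 \<omega> = 1 \<and> successes (Suc 0) \<omega> = Suc m) = 0"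
      by (simp only: measure_empty)
    moreover have "urn_weight b r A 0 m = 0" using Suc by (simp add: urn_weight_def)
    ultimately show ?thesis by (simp only: mult_zero_right)
  qed
next
  case (Suc n)
  let ?P = "\<lambda>m. \<P>(\<omega> in M. X 1 \<omega> = 1 \<and> successes (Suc n) \<omega> = m)"
  let ?d = "b + r + A * real (n + 1)"
  have [measurable]: "X 1 \<in> measurable M (count_space UNIV)" using X_measurable by simp
  let ?E = "{\<omega> \<in> space M. X 1 \<omega> = 1 \<and> successes (Suc (Suc n)) \<omega> = Suc m}"
  let ?Ef = "{\<omega> \<in> space M. X 1 \<omega> = 1 \<and> successes (Suc n) \<omega> = Suc m \<and> X (Suc (Suc n)) \<omega> = 0}"
  let ?Es = "{\<omega> \<in> space M. X 1 \<omega> = 1 \<and> successes (Suc n) \<omega> = m \<and> X (Suc (Suc n)) \<omega> = 1}"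
  have "?E = ?Ef \<union> ?Es"
  proof (intro set_eqI iffI)
    fix \<omega> assume "\<omega> \<in> ?E"
    then show "\<omega> \<in> ?Ef \<union> ?Es" using X_cases[of \<omega> "Suc n"] by auto
  qed auto
  then have "prob ?E = prob (?Ef \<union> ?Es)" by (simp only:)
  also have "\<dots> = prob ?Ef + prob ?Es"
  proof (rule finite_measure_Union)
    show "?Ef \<in> events" "?Es \<in> events" by measurable
  qed auto
  also have "\<dots> = ?P (Suc m) * ((r + A * (real n - real m)) / ?d) + ?P m * ((b + A * real m) / ?d)"
    by (subst prob_next_failure prob_next_success, simp)+ simp
  finally have rec: "\<P>(\<omega> in M. X 1 \<omega> = 1 \<and> successes (Suc (Suc n)) \<omega> = Suc m) = \<dots>" .
  show ?case
  proof (cases m)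
    case 0
    have "{\<omega> \<in> space M. X 1 \<omega> = 1 \<and> successes (Suc n) \<omega> = 0} = {}"
      by (auto simp del: sum.cl_ivl_Suc intro!: bexI[of _ "Suc 0"])
    then have P0: "?P m = 0" using 0 by (metis measure_empty)
    show ?thesis unfolding rec P0 unfolding Suc.IH 0 urn_weight_Suc_0 by simp
  next
    case (Suc m')
    have "real n - real (Suc m') = real n - real m' - 1" by simp
    then show ?thesis unfolding rec unfolding Suc Suc.IH urn_weight_Suc_Suc
      by (simp only: distrib_left mult.assoc Suc_eq_plus1)
  qed
qed

lemma vel_eq_c_iff: "vel c v X n \<omega> = c \<longleftrightarrow> X (Suc n) \<omega> = 1"
  using c_pos v_pos by (auto simp: vel_def)

lemma vel_eq_neg_v_iff: "\<omega> \<in> space M \<Longrightarrow> vel c v X n \<omega> = - v \<longleftrightarrow> X (Suc n) \<omega> = 0"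
  using c_pos v_pos X_values[of "Suc n" \<omega>] by (auto simp: vel_def)

lemma nforward_eq:
  assumes "\<omega> \<in> space M" "X 1 \<omega> = 1"
  shows "Suc (nforward c v X n \<omega>) = successes (Suc n) \<omega>"
proof -
  have "of_bool (vel c v X i \<omega> = c) = X (Suc i) \<omega>" for i
    using X_values[of "Suc i" \<omega>] assms by (auto simp: vel_eq_c_iff)
  then have "nforward c v X n \<omega> = (\<Sum>i = 1..n. X (Suc i) \<omega>)"
    by (simp add: nforward_def)
  also have "\<dots> = (\<Sum>i = Suc 1..Suc n. X i \<omega>)"
    by (simp only: sum.shift_bounds_cl_Suc_ivl)
  finally show ?thesis
    using assms sum.atLeast_Suc_atMost[of 1 "Suc n" "\<lambda>i. X i \<omega>"] by simp
qed

lemma nforward_eq_iff: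
  assumes "\<omega> \<in> space M" "X 1 \<omega> = 1" "1 \<le> k"
  shows "nforward c v X (k - 1) \<omega> = j \<longleftrightarrow> successes k \<omega> = Suc j"
  using nforward_eq[OF assms(1,2), of "k - 1"] assms(3) by (metis Suc_inject Suc_diff_1 less_eq_Suc_le One_nat_def)

lemma cond_prob_forward:
  assumes k: "1 \<le> k"
  shows "\<P>(\<omega> in M. (nforward c v X (k - 1) \<omega> = j \<and> vel c v X k \<omega> = c) \<bar> vel c v X 0 \<omega> = c)
    = \<P>(\<omega> in M. X 1 \<omega> = 1 \<and> successes k \<omega> = Suc j \<and> X (Suc k) \<omega> = 1) / \<P>(\<omega> in M. X 1 \<omega> = 1)"
proof -
  have "{\<omega> \<in> space M. (nforward c v X (k - 1) \<omega> = j \<and> vel c v X k \<omega> = c) \<and> vel c v X 0 \<omega> = c}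
    = {\<omega> \<in> space M. X 1 \<omega> = 1 \<and> successes k \<omega> = Suc j \<and> X (Suc k) \<omega> = 1}"
    using nforward_eq_iff[OF _ _ k, of _ j] by (metis (mono_tags, lifting) vel_eq_c_iff vel_eq_neg_v_iff One_nat_def)
  then show ?thesis by (simp add: cond_prob_def vel_eq_c_iff)
qed

lemma cond_prob_backward:
  assumes k: "1 \<le> k"
  shows "\<P>(\<omega> in M. (nforward c v X (k - 1) \<omega> = j \<and> vel c v X k \<omega> = - v) \<bar> vel c v X 0 \<omega> = c)
    = \<P>(\<omega> in M. X 1 \<omega> = 1 \<and> successes k \<omega> = Suc j \<and> X (Suc k) \<omega> = 0) / \<P>(\<omega> in M. X 1 \<omega> = 1)"
proof -
  have "{\<omega> \<in> space M. (nforward c v X (k - 1) \<omega> = j \<and> vel c v X k \<omega> = - v) \<and> vel c v X 0 \<omega> = c}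
    = {\<omega> \<in> space M. X 1 \<omega> = 1 \<and> successes k \<omega> = Suc j \<and> X (Suc k) \<omega> = 0}"
    using nforward_eq_iff[OF _ _ k, of _ j] by (metis (mono_tags, lifting) vel_eq_c_iff vel_eq_neg_v_iff One_nat_def)
  then show ?thesis by (simp add: cond_prob_def vel_eq_c_iff)
qed

lemma cond_prob_forward_eq:
  assumes k: "1 \<le> k" and j: "j \<le> k - 1"
  shows "\<P>(\<omega> in M. (nforward c v X (k - 1) \<omega> = j \<and> vel c v X k \<omega> = c) \<bar> vel c v X 0 \<omega> = c)
    = real (k - 1 choose j) * ((\<Prod>i<j + 1. b + A * real (i + 1)) * (\<Prod>i<k - j - 1. r + A * real i)
        / (\<Prod>i<k. b + r + A * real (i + 1)))"
proof -
  obtain n where n: "k = Suc n" using k by (cases k) auto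
  show ?thesis
    unfolding cond_prob_forward[OF k] prob_next_success[OF k] unfolding n prob_successes
    using b_pos r_pos unfolding X_first by (simp add: urn_weight_def n mult_ac)
qed

lemma cond_prob_backward_eq:
  assumes k: "1 \<le> k" and j: "j \<le> k - 1"
  shows "\<P>(\<omega> in M. (nforward c v X (k - 1) \<omega> = j \<and> vel c v X k \<omega> = - v) \<bar> vel c v X 0 \<omega> = c)
    = real (k - 1 choose j) * ((\<Prod>i<j. b + A * real (i + 1)) * (\<Prod>i<k - j. r + A * real i)
        / (\<Prod>i<k. b + r + A * real (i + 1)))"
proof -
  obtain n where n: "k = Suc n" using k by (cases k) auto
  have nj: "Suc n - j = Suc (n - j)" "real (n - j) = real n - real j" using j n by auto
  show ?thesis
    unfolding cond_prob_backward[OF k] prob_next_failure[OF k] unfolding n prob_successes nj prod.lessThan_Suc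
    using b_pos r_pos unfolding X_first by (simp add: urn_weight_def n nj mult_ac)
qed

lemma cond_prob_bernoulli:
  assumes k: "1 \<le> k" and j: "j \<le> k - 1" and A: "A = 0"
  shows "let p = b / (b + r) in
          \<P>(\<omega> in M. (nforward c v X (k - 1) \<omega> = j \<and> vel c v X k \<omega> = c) \<bar> vel c v X 0 \<omega> = c)
            = real ((k - 1) choose j) * p ^ (j + 1) * (1 - p) ^ (k - 1 - j)
        \<and> \<P>(\<omega> in M. (nforward c v X (k - 1) \<omega> = j \<and> vel c v X k \<omega> = - v) \<bar> vel c v X 0 \<omega> = c)
            = real ((k - 1) choose j) * p ^ j * (1 - p) ^ (k - j)"
proof -
  note fw = cond_prob_forward_eq[OF k j] and bw = cond_prob_backward_eq[OF k j]
  have p: "1 - b / (b + r) = r / (b + r)" using b_pos r_pos by (simp add: field_simps)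
  have e: "(b + r) ^ k = (b + r) ^ (j + 1) * (b + r) ^ (k - 1 - j)" "(b + r) ^ k = (b + r) ^ j * (b + r) ^ (k - j)"
    using k j by (simp_all only: power_add[symmetric]) auto
  have "b ^ (j + 1) * r ^ (k - 1 - j) / (b + r) ^ k = (b / (b + r)) ^ (j + 1) * (r / (b + r)) ^ (k - 1 - j)"
    unfolding e(1) by (simp only: power_divide times_divide_times_eq)
  moreover have "b ^ j * r ^ (k - j) / (b + r) ^ k = (b / (b + r)) ^ j * (r / (b + r)) ^ (k - j)"
    unfolding e(2) by (simp only: power_divide times_divide_times_eq)
  ultimately show ?thesis
    unfolding Let_def p fw bw A
    by (simp add: mult.assoc del: power_Suc)
qed

lemma cond_prob_polya:
  assumes k: "1 \<le> k" and j: "j \<le> k - 1" and A: "0 < A"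
  shows "\<P>(\<omega> in M. (nforward c v X (k - 1) \<omega> = j \<and> vel c v X k \<omega> = c) \<bar> vel c v X 0 \<omega> = c)
            = real ((k - 1) choose j) * (pochhammer ((b + A) / A) (j + 1) * pochhammer (r / A) (k - j - 1)
                / pochhammer ((b + A + r) / A) k)" (is ?fw)
    and "\<P>(\<omega> in M. (nforward c v X (k - 1) \<omega> = j \<and> vel c v X k \<omega> = - v) \<bar> vel c v X 0 \<omega> = c)
            = real ((k - 1) choose j) * (pochhammer ((b + A) / A) j * pochhammer (r / A) (k - j)
                / pochhammer ((b + A + r) / A) k)" (is ?bw)
proof -
  note fw = cond_prob_forward_eq[OF k j] and bw = cond_prob_backward_eq[OF k j]
  have shift: "(\<Prod>i<n. z + A * real (i + 1)) = A ^ n * pochhammer ((z + A) / A) n" for z n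
    using prod_affine_eq_pochhammer[OF A, of "z + A" n] by (simp add: algebra_simps)
  have e: "A ^ k = A ^ (j + 1) * A ^ (k - j - 1)" "A ^ k = A ^ j * A ^ (k - j)"
    using k j by (simp_all only: power_add[symmetric]) auto
  have com: "b + r + A = b + A + r" by simp
  note prods = shift[of b] shift[of "b + r", unfolded com] prod_affine_eq_pochhammer[OF A]
  show ?fw
    unfolding fw prods e(1) using A by simp
  show ?bw
    unfolding bw prods e(2) using A by simp
qed

section \<open>Paths of the process\<close>

lemma durations_measurable:
  assumes "1 \<le> k" shows "random_variable borel (U k)" "random_variable borel (D k)"
proof -
  have "random_variable borel (case_sum U D i)" if "i \<in> {1..} <+> {1..}" for i
    using UD_indep that by (auto simp: indep_vars_def)
  from this[of "Inl k"] this[of "Inr k"] assms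
  show "random_variable borel (U k)" "random_variable borel (D k)" by auto
qed

lemma successes_le: "\<omega> \<in> space M \<Longrightarrow> successes n \<omega> \<le> n"
proof (induction n)
  case (Suc n)
  then show ?case using X_cases[of \<omega> n] by auto
qed simp

lemma epoch_eq:
  assumes "\<omega> \<in> space M"
  shows "epoch X U D n \<omega> = (\<Sum>i = 1..successes n \<omega>. U i \<omega>) + (\<Sum>i = 1..n - successes n \<omega>. D i \<omega>)"
proof (induction n)
  case (Suc n)
  have le: "successes n \<omega> \<le> n" by (rule successes_le[OF assms])
  from X_cases[OF assms, of n] show ?case
  proof
    assume "X (Suc n) \<omega> = 0"
    then show ?thesis using Suc le by (simp add: Suc_diff_le)
  next
    assume "X (Suc n) \<omega> = 1"
    then show ?thesis using Suc le by simp
  qed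
qed simp

lemma epoch_measurable [measurable]: "random_variable borel (epoch X U D n)"
proof (induction n)
  case 0
  have "(\<lambda>\<omega>. epoch X U D 0 \<omega>) = (\<lambda>_. 0)" by simp
  then show ?case by (simp add: fun_eq_iff)
next
  case (Suc n)
  \<comment> \<open>\<open>U 0\<close> and \<open>D 0\<close> need not be measurable, but the epochs never use these indices.\<close>
  define U' where "U' j = (if 1 \<le> j then U j else (\<lambda>_. 0))" for j
  define D' where "D' j = (if 1 \<le> j then D j else (\<lambda>_. 0))" for j
  have [measurable]: "random_variable borel (U' j)" "random_variable borel (D' j)" for j
    using durations_measurable[of j] by (auto simp: U'_def D'_def)
  have [measurable]: "random_variable borel (epoch X U D n)" by fact
  have "random_variable borel (\<lambda>\<omega>. U' (successes (Suc n) \<omega>) \<omega>)"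
    by (rule measurable_compose_countable[where f=U', OF _ successes_measurable]) simp
  moreover have "random_variable borel (\<lambda>\<omega>. D' (Suc n - successes (Suc n) \<omega>) \<omega>)"
    by (rule measurable_compose_countable[where f="\<lambda>j. D' (Suc n - j)", OF _ successes_measurable]) simp
  ultimately have "random_variable borel (\<lambda>\<omega>. epoch X U D n \<omega> +
    (if X (Suc n) \<omega> = 1 then U' (successes (Suc n) \<omega>) \<omega> else D' (Suc n - successes (Suc n) \<omega>) \<omega>))"
    by measurable
  then show ?case
  proof (rule measurable_cong[THEN iffD1, rotated])
    fix \<omega> assume \<omega>: "\<omega> \<in> space M"
    show "epoch X U D n \<omega> + (if X (Suc n) \<omega> = 1 then U' (successes (Suc n) \<omega>) \<omega> else D' (Suc n - successes (Suc n) \<omega>) \<omega>)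
      = epoch X U D (Suc n) \<omega>"
      using X_cases[OF \<omega>, of n] successes_le[OF \<omega>, of n] by (auto simp: U'_def D'_def)
  qed
qed

lemma vel_measurable [measurable]: "random_variable borel (vel c v X n)"
proof -
  have "random_variable borel (\<lambda>\<omega>. if X (Suc n) \<omega> = 1 then c else - v)" by measurable
  then show ?thesis by (simp add: vel_def[abs_def])
qed

lemma nchanges_measurable_pair [measurable]:
  "(\<lambda>z. nchanges X U D (fst z) (snd z)) \<in> measurable (borel \<Otimes>\<^sub>M M) (count_space UNIV)"
  unfolding nchanges_def by measurable

lemma velocity_measurable_pair [measurable]:
  "(\<lambda>z. velocity c v X U D (fst z) (snd z)) \<in> borel_measurable (borel \<Otimes>\<^sub>M M)"
  unfolding velocity_def
  by (rule measurable_compose_countable[where f="\<lambda>n z. vel c v X n (snd z)"]) measurable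

lemma nchanges_measurable [measurable]: "nchanges X U D t \<in> measurable M (count_space UNIV)"
  using measurable_compose[OF measurable_Pair1' nchanges_measurable_pair, of t] by simp

lemma velocity_measurable [measurable]: "random_variable borel (velocity c v X U D t)"
  using measurable_compose[OF measurable_Pair1' velocity_measurable_pair, of t] by simp

lemma velocity_path_measurable: "\<omega> \<in> space M \<Longrightarrow> (\<lambda>s. velocity c v X U D s \<omega>) \<in> borel_measurable borel"
  using measurable_compose[OF measurable_Pair2' velocity_measurable_pair, of \<omega>] by simp

text \<open>
The velocity is jointly measurable in time and outcome, whence its time integral is measurable in the
outcome. Measurability is needed on the whole space: \<open>M\<close> need not be complete, and an event that only
agrees almost surely with a measurable one could have the default measure \<open>0\<close>.
\<close>

lemma position_measurable [measurable]: "random_variable borel (position c v X U D t)"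
proof -
  have "(\<lambda>(\<omega>, s). indicator {0..t} s *\<^sub>R velocity c v X U D s \<omega>) \<in> borel_measurable (M \<Otimes>\<^sub>M lborel)"
  proof -
    have "(\<lambda>z. (snd z, fst z)) \<in> measurable (M \<Otimes>\<^sub>M lborel) (borel \<Otimes>\<^sub>M M)" by measurable
    from measurable_compose[OF this velocity_measurable_pair]
    have [measurable]: "(\<lambda>z. velocity c v X U D (snd z) (fst z)) \<in> borel_measurable (M \<Otimes>\<^sub>M lborel)" by simp
    have "(\<lambda>z. indicator {0..t} (snd z) *\<^sub>R velocity c v X U D (snd z) (fst z)) \<in> borel_measurable (M \<Otimes>\<^sub>M lborel)"
      by measurable
    then show ?thesis by (simp add: case_prod_beta')
  qed
  then have "(\<lambda>\<omega>. \<integral>s. indicator {0..t} s *\<^sub>R velocity c v X U D s \<omega> \<partial>lborel) \<in> borel_measurable M"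
    by (rule lborel.borel_measurable_lebesgue_integral)
  then show ?thesis
    by (simp add: position_def[abs_def] set_lebesgue_integral_def)
qed

text \<open>
The almost sure properties of the durations that make the path piecewise linear with a
well-defined number of completed periods at every time, and that make the first period non-trivial.
\<close>

definition regular_path :: "'a \<Rightarrow> bool" where
  "regular_path \<omega> \<longleftrightarrow> \<omega> \<in> space M \<and> (\<forall>k\<ge>1. 0 \<le> U k \<omega> \<and> 0 \<le> D k \<omega>) \<and> U 1 \<omega> \<noteq> 0 \<and> D 1 \<omega> \<noteq> 0 \<and>
     filterlim (\<lambda>n. epoch X U D n \<omega>) at_top sequentially"

lemma AE_regular_path: "AE \<omega> in M. regular_path \<omega>"
proof -
  have nz: "AE \<omega> in M. Y \<omega> \<noteq> 0"
    if Y: "random_variable borel Y" "absolutely_continuous lborel (distr M borel Y)" for Y :: "'a \<Rightarrow> real"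
  proof -
    have "{0} \<in> null_sets (distr M borel Y)"
      using Y(2) finite_imp_null_set_lborel[of "{0}"] by (auto simp: absolutely_continuous_def)
    then have "AE y in distr M borel Y. y \<notin> {0}" by (rule AE_not_in)
    then show ?thesis using AE_distrD[OF Y(1)] by fastforce
  qed
  have "AE \<omega> in M. \<forall>k. 1 \<le> k \<longrightarrow> 0 \<le> U k \<omega>" "AE \<omega> in M. \<forall>k. 1 \<le> k \<longrightarrow> 0 \<le> D k \<omega>"
    using U_nonneg D_nonneg by (simp_all add: AE_all_countable)
  moreover have "AE \<omega> in M. U 1 \<omega> \<noteq> 0" "AE \<omega> in M. D 1 \<omega> \<noteq> 0"
    using nz[OF durations_measurable(1) U_ac, of 1] nz[OF durations_measurable(2) D_ac, of 1] by auto
  ultimately show ?thesis using epoch_at_top AE_space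
    by eventually_elim (auto simp: regular_path_def)
qed

lemma regular_pathD:
  assumes "regular_path \<omega>"
  shows "\<omega> \<in> space M" "1 \<le> k \<Longrightarrow> 0 \<le> U k \<omega>" "1 \<le> k \<Longrightarrow> 0 \<le> D k \<omega>" "0 < U 1 \<omega>" "0 < D 1 \<omega>"
    "filterlim (\<lambda>n. epoch X U D n \<omega>) at_top sequentially"
  using assms unfolding regular_path_def by (auto simp: less_le)

lemma incseq_epoch:
  assumes "regular_path \<omega>" shows "incseq (\<lambda>n. epoch X U D n \<omega>)"
proof (rule incseq_SucI)
  fix n
  note \<omega> = regular_pathD[OF assms]
  show "epoch X U D n \<omega> \<le> epoch X U D (Suc n) \<omega>"
    using X_cases[OF \<omega>(1), of n] successes_le[OF \<omega>(1), of n] \<omega>(2,3) by auto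
qed

lemma epoch_nonneg: "regular_path \<omega> \<Longrightarrow> 0 \<le> epoch X U D n \<omega>"
  using incseqD[OF incseq_epoch, of \<omega> 0 n] by simp

lemma nchanges_eqI:
  assumes \<omega>: "regular_path \<omega>" and k: "epoch X U D k \<omega> \<le> t" "t < epoch X U D (Suc k) \<omega>"
  shows "nchanges X U D t \<omega> = k"
proof (cases k)
  case 0
  then show ?thesis using k by (simp add: nchanges_def del: epoch.simps)
next
  case (Suc m)
  have "epoch X U D 1 \<omega> \<le> t"
    using incseqD[OF incseq_epoch[OF \<omega>], of 1 k] Suc k(1) by linarith
  moreover have "Max {i. 1 \<le> i \<and> epoch X U D i \<omega> \<le> t} = k"
  proof (rule Max_eqI)
    have le: "i \<le> k" if "epoch X U D i \<omega> \<le> t" for i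
    proof (rule ccontr)
      assume "\<not> i \<le> k"
      then have "epoch X U D (Suc k) \<omega> \<le> epoch X U D i \<omega>"
        by (intro incseqD[OF incseq_epoch[OF \<omega>]]) simp
      then show False using that k(2) by linarith
    qed
    show "finite {i. 1 \<le> i \<and> epoch X U D i \<omega> \<le> t}"
      by (rule finite_subset[of _ "{..k}"]) (use le in auto)
    show "i \<le> k" if "i \<in> {i. 1 \<le> i \<and> epoch X U D i \<omega> \<le> t}" for i
      using that le by blast
  qed (use Suc k in auto)
  ultimately show ?thesis by (simp add: nchanges_def del: epoch.simps)
qed

lemma nchanges_eq_iff:
  assumes \<omega>: "regular_path \<omega>" and t: "0 \<le> t"
  shows "nchanges X U D t \<omega> = k \<longleftrightarrow> epoch X U D k \<omega> \<le> t \<and> t < epoch X U D (Suc k) \<omega>"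
proof
  have "\<exists>n. t < epoch X U D n \<omega>"
    using regular_pathD(6)[OF \<omega>] by (auto simp: filterlim_at_top_dense eventually_sequentially)
  define n where "n = (LEAST n. t < epoch X U D n \<omega>)"
  have n: "t < epoch X U D n \<omega>"
    unfolding n_def by (rule LeastI_ex) fact
  have n_min: "epoch X U D m \<omega> \<le> t" if "m < n" for m
    using not_less_Least[of m "\<lambda>n. t < epoch X U D n \<omega>"] that by (simp add: n_def)
  obtain k' where k': "n = Suc k'" using t n by (cases n) auto
  then have k'_t: "epoch X U D k' \<omega> \<le> t \<and> t < epoch X U D (Suc k') \<omega>"
    using n n_min[of k'] by (auto simp del: epoch.simps)
  moreover from k'_t have "nchanges X U D t \<omega> = k'" by (intro nchanges_eqI[OF \<omega>]) auto
  moreover assume "nchanges X U D t \<omega> = k"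
  ultimately show "epoch X U D k \<omega> \<le> t \<and> t < epoch X U D (Suc k) \<omega>" by (simp del: epoch.simps)
qed (auto intro!: nchanges_eqI[OF \<omega>] simp del: epoch.simps)

text \<open>
A first period of length \<open>0\<close> would let the velocity at time \<open>0\<close> differ from the first trial; on a
regular path this does not happen.
\<close>

lemma velocity_start:
  assumes \<omega>: "regular_path \<omega>"
  shows "velocity c v X U D 0 \<omega> = c \<longleftrightarrow> X 1 \<omega> = 1"
proof -
  note r = regular_pathD[OF \<omega>]
  have "0 < epoch X U D (Suc 0) \<omega>"
    using X_cases[OF r(1), of 0] r(4,5) by auto
  then have "nchanges X U D 0 \<omega> = 0" by (intro nchanges_eqI[OF \<omega>]) auto
  then show ?thesis by (simp add: velocity_def vel_eq_c_iff)
qed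

text \<open>
Between consecutive epochs the velocity is constant except possibly at the end points.
\<close>

lemma velocity_has_integral:
  assumes \<omega>: "regular_path \<omega>"
  shows "((\<lambda>s. velocity c v X U D s \<omega>) has_integral
    c * (\<Sum>i = 1..successes n \<omega>. U i \<omega>) - v * (\<Sum>i = 1..n - successes n \<omega>. D i \<omega>)) {0..epoch X U D n \<omega>}"
    and "epoch X U D n \<omega> \<le> t \<Longrightarrow> t \<le> epoch X U D (Suc n) \<omega> \<Longrightarrow>
    ((\<lambda>s. velocity c v X U D s \<omega>) has_integral vel c v X n \<omega> * (t - epoch X U D n \<omega>)) {epoch X U D n \<omega>..t}"
proof -
  note r = regular_pathD[OF \<omega>]
  have piece: "((\<lambda>s. velocity c v X U D s \<omega>) has_integral vel c v X n \<omega> * (t - epoch X U D n \<omega>)) {epoch X U D n \<omega>..t}"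
    if t: "epoch X U D n \<omega> \<le> t" "t \<le> epoch X U D (Suc n) \<omega>" for n t
  proof -
    have "((\<lambda>_. vel c v X n \<omega>) has_integral vel c v X n \<omega> * (t - epoch X U D n \<omega>)) {epoch X U D n \<omega>..t}"
      using has_integral_const_real[of "vel c v X n \<omega>" "epoch X U D n \<omega>" t] t(1) by (simp add: mult.commute)
    moreover have "velocity c v X U D s \<omega> = vel c v X n \<omega>" if "s \<in> {epoch X U D n \<omega><..<t}" for s
      using nchanges_eqI[OF \<omega>, of n s] that t by (simp add: velocity_def del: epoch.simps)
    ultimately show ?thesis
      using has_integral_spike_interior[of "\<lambda>_. vel c v X n \<omega>" _ "epoch X U D n \<omega>" t "\<lambda>s. velocity c v X U D s \<omega>"]
      by simp
  qed
  then show "epoch X U D n \<omega> \<le> t \<Longrightarrow> t \<le> epoch X U D (Suc n) \<omega> \<Longrightarrow>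
    ((\<lambda>s. velocity c v X U D s \<omega>) has_integral vel c v X n \<omega> * (t - epoch X U D n \<omega>)) {epoch X U D n \<omega>..t}" .
  show "((\<lambda>s. velocity c v X U D s \<omega>) has_integral
    c * (\<Sum>i = 1..successes n \<omega>. U i \<omega>) - v * (\<Sum>i = 1..n - successes n \<omega>. D i \<omega>)) {0..epoch X U D n \<omega>}"
  proof (induction n)
    case (Suc n)
    have le: "successes n \<omega> \<le> n" by (rule successes_le[OF r(1)])
    have inc: "epoch X U D n \<omega> \<le> epoch X U D (Suc n) \<omega>" by (rule incseqD[OF incseq_epoch[OF \<omega>]]) simp
    have "vel c v X n \<omega> * (epoch X U D (Suc n) \<omega> - epoch X U D n \<omega>) =
      (c * (\<Sum>i = 1..successes (Suc n) \<omega>. U i \<omega>) - v * (\<Sum>i = 1..Suc n - successes (Suc n) \<omega>. D i \<omega>)) -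
      (c * (\<Sum>i = 1..successes n \<omega>. U i \<omega>) - v * (\<Sum>i = 1..n - successes n \<omega>. D i \<omega>))"
      using X_cases[OF r(1), of n]
    proof
      assume "X (Suc n) \<omega> = 0"
      then show ?thesis using le by (simp add: vel_def Suc_diff_le algebra_simps)
    next
      assume "X (Suc n) \<omega> = 1"
      then show ?thesis using le by (simp add: vel_def algebra_simps)
    qed
    with has_integral_combine[OF epoch_nonneg[OF \<omega>] inc Suc piece[OF inc order_refl]]
    show ?case by (simp del: epoch.simps sum.cl_ivl_Suc)
  qed (simp add: has_integral_refl)
qed

lemma position_eq:
  assumes \<omega>: "regular_path \<omega>" and t: "0 \<le> t" "nchanges X U D t \<omega> = n"
  shows "position c v X U D t \<omega> = c * (\<Sum>i = 1..successes n \<omega>. U i \<omega>) - v * (\<Sum>i = 1..n - successes n \<omega>. D i \<omega>)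
    + vel c v X n \<omega> * (t - epoch X U D n \<omega>)"
proof -
  note r = regular_pathD[OF \<omega>]
  have n: "epoch X U D n \<omega> \<le> t" "t \<le> epoch X U D (Suc n) \<omega>"
    using t nchanges_eq_iff[OF \<omega> t(1), of n] by auto
  have "set_integrable lborel {0..t} (\<lambda>s. velocity c v X U D s \<omega>)"
    unfolding set_integrable_def
  proof (rule Bochner_Integration.integrable_bound)
    show "integrable lborel (\<lambda>s. max c v * indicator {0..t} s)"
      using t(1) by (intro integrable_mult_right integrable_real_indicator) auto
    show "(\<lambda>s. indicator {0..t} s *\<^sub>R velocity c v X U D s \<omega>) \<in> borel_measurable lborel"
      using velocity_path_measurable[OF r(1)] by simp
    show "AE s in lborel. norm (indicator {0..t} s *\<^sub>R velocity c v X U D s \<omega>) \<le> norm (max c v * indicator {0..t} s)"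
      using c_pos v_pos by (intro AE_I2) (auto simp: velocity_def vel_def split: split_indicator)
  qed
  then have "position c v X U D t \<omega> = integral {0..t} (\<lambda>s. velocity c v X U D s \<omega>)"
    unfolding position_def by (rule set_borel_integral_eq_integral(2))
  also have "\<dots> = c * (\<Sum>i = 1..successes n \<omega>. U i \<omega>) - v * (\<Sum>i = 1..n - successes n \<omega>. D i \<omega>)
    + vel c v X n \<omega> * (t - epoch X U D n \<omega>)"
    using has_integral_combine[OF epoch_nonneg[OF \<omega>] n(1) velocity_has_integral(1)[OF \<omega>]
      velocity_has_integral(2)[OF \<omega> n]] by (rule integral_unique)
  finally show ?thesis .
qed

lemma successes_pos: "X 1 \<omega> = 1 \<Longrightarrow> 1 \<le> k \<Longrightarrow> 1 \<le> successes k \<omega>"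
  using member_le_sum[of 1 "{1..k}" "\<lambda>i. X i \<omega>"] by simp

lemma velocity_eq_vel: "nchanges X U D t \<omega> = k \<Longrightarrow> velocity c v X U D t \<omega> = vel c v X k \<omega>"
  by (simp add: velocity_def)

text \<open>
When the particle moves forward at time \<open>t\<close> after \<open>k\<close> periods, its forward time is \<open>t\<close> minus the total
\<open>D\<close> of the backward periods, so its position is \<open>c (t - D) - v D\<close>. The index \<open>j = k - 1\<close> does
not occur because it leaves no backward periods, and then the position is the end point \<open>c t\<close>.
\<close>

lemma forward_path_iff:
  assumes \<omega>: "regular_path \<omega>" and t: "0 < t" and k: "1 \<le> k" and B: "B \<subseteq> {- v * t<..<c * t}"
  shows "(position c v X U D t \<omega> \<in> B \<and> velocity c v X U D t \<omega> = c \<and> nchanges X U D t \<omega> = k) \<and>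
      velocity c v X U D 0 \<omega> = c \<longleftrightarrow>
    (\<exists>j\<in>{..<k - 1}. (X 1 \<omega> = 1 \<and> successes k \<omega> = Suc j \<and> X (Suc k) \<omega> = 1) \<and>
      c * t + - (c + v) * (\<Sum>i = 1..k - j - 1. D i \<omega>) \<in> B \<and>
      (\<Sum>i = 1..k - j - 1. D i \<omega>) + (\<Sum>i = 1..j + 1. U i \<omega>) \<le> t \<and>
      t < (\<Sum>i = 1..k - j - 1. D i \<omega>) + (\<Sum>i = 1..j + 1. U i \<omega>) + U (j + 2) \<omega>)"
    (is "?L \<longleftrightarrow> ?R")
proof -
  note r = regular_pathD[OF \<omega>]
  have le: "successes k \<omega> \<le> k" by (rule successes_le[OF r(1)])
  have ep: "epoch X U D k \<omega> = (\<Sum>i = 1..successes k \<omega>. U i \<omega>) + (\<Sum>i = 1..k - successes k \<omega>. D i \<omega>)"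
    by (rule epoch_eq[OF r(1)])
  have ep': "X (Suc k) \<omega> = 1 \<Longrightarrow> epoch X U D (Suc k) \<omega> = epoch X U D k \<omega> + U (Suc (successes k \<omega>)) \<omega>"
    by simp
  have pos: "nchanges X U D t \<omega> = k \<Longrightarrow> X (Suc k) \<omega> = 1 \<Longrightarrow>
    position c v X U D t \<omega> = c * t + - (c + v) * (\<Sum>i = 1..k - successes k \<omega>. D i \<omega>)"
    using position_eq[OF \<omega>, of t k] t unfolding ep by (simp add: vel_def algebra_simps)
  have nch: "nchanges X U D t \<omega> = k \<longleftrightarrow> epoch X U D k \<omega> \<le> t \<and> t < epoch X U D (Suc k) \<omega>"
    by (rule nchanges_eq_iff[OF \<omega>]) (use t in simp)
  show ?thesis
  proof
    assume L: ?L
    then have X1: "X 1 \<omega> = 1" and Xk: "X (Suc k) \<omega> = 1" and n: "nchanges X U D t \<omega> = k"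
      using velocity_start[OF \<omega>] by (auto simp: velocity_def vel_eq_c_iff)
    obtain j where j: "successes k \<omega> = Suc j"
      using successes_pos[OF X1 k] by (cases "successes k \<omega>") auto
    have "j \<noteq> k - 1"
    proof
      assume "j = k - 1"
      then have "position c v X U D t \<omega> = c * t" using pos[OF n Xk] j k by simp
      then show False using L B by auto
    qed
    then have "j \<in> {..<k - 1}" using j le by simp
    moreover have "k - successes k \<omega> = k - j - 1" using j by simp
    ultimately show ?R
      using L X1 Xk j pos[OF n Xk] nch n ep'[OF Xk] unfolding ep
      by (intro bexI[of _ j]) (simp_all add: add.commute del: sum.cl_ivl_Suc epoch.simps)
  next
    assume ?R
    then obtain j where j: "X 1 \<omega> = 1" "successes k \<omega> = Suc j" "X (Suc k) \<omega> = 1"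
      "c * t + - (c + v) * (\<Sum>i = 1..k - j - 1. D i \<omega>) \<in> B"
      "(\<Sum>i = 1..k - j - 1. D i \<omega>) + (\<Sum>i = 1..j + 1. U i \<omega>) \<le> t"
      "t < (\<Sum>i = 1..k - j - 1. D i \<omega>) + (\<Sum>i = 1..j + 1. U i \<omega>) + U (j + 2) \<omega>" by blast
    have d: "k - successes k \<omega> = k - j - 1" using j(2) by simp
    have n: "nchanges X U D t \<omega> = k"
      unfolding nch ep'[OF j(3)] ep d using j by (simp add: add.commute del: sum.cl_ivl_Suc)
    then show ?L
      using pos[OF n j(3)] j velocity_start[OF \<omega>] d
      by (simp add: velocity_eq_vel[OF n] vel_eq_c_iff del: sum.cl_ivl_Suc)
  qed
qed

text \<open>
When the particle moves backward at time \<open>t\<close>, its forward time is the total \<open>U\<close> of the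
forward periods, so its position is \<open>c U - v (t - U)\<close>.
\<close>

lemma backward_path_iff:
  assumes \<omega>: "regular_path \<omega>" and t: "0 < t" and k: "1 \<le> k"
  shows "(position c v X U D t \<omega> \<in> B \<and> velocity c v X U D t \<omega> = - v \<and> nchanges X U D t \<omega> = k) \<and>
      velocity c v X U D 0 \<omega> = c \<longleftrightarrow>
    (\<exists>j\<in>{..<k}. (X 1 \<omega> = 1 \<and> successes k \<omega> = Suc j \<and> X (Suc k) \<omega> = 0) \<and>
      - v * t + (c + v) * (\<Sum>i = 1..j + 1. U i \<omega>) \<in> B \<and>
      (\<Sum>i = 1..j + 1. U i \<omega>) + (\<Sum>i = 1..k - j - 1. D i \<omega>) \<le> t \<and>
      t < (\<Sum>i = 1..j + 1. U i \<omega>) + (\<Sum>i = 1..k - j - 1. D i \<omega>) + D (k - j) \<omega>)"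
    (is "?L \<longleftrightarrow> ?R")
proof -
  note r = regular_pathD[OF \<omega>]
  have le: "successes k \<omega> \<le> k" by (rule successes_le[OF r(1)])
  have ep: "epoch X U D k \<omega> = (\<Sum>i = 1..successes k \<omega>. U i \<omega>) + (\<Sum>i = 1..k - successes k \<omega>. D i \<omega>)"
    by (rule epoch_eq[OF r(1)])
  have ep': "X (Suc k) \<omega> = 0 \<Longrightarrow> epoch X U D (Suc k) \<omega> = epoch X U D k \<omega> + D (Suc k - successes k \<omega>) \<omega>"
    by simp
  have pos: "nchanges X U D t \<omega> = k \<Longrightarrow> X (Suc k) \<omega> = 0 \<Longrightarrow>
    position c v X U D t \<omega> = - v * t + (c + v) * (\<Sum>i = 1..successes k \<omega>. U i \<omega>)"
    using position_eq[OF \<omega>, of t k] t unfolding ep by (simp add: vel_def algebra_simps)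
  have nch: "nchanges X U D t \<omega> = k \<longleftrightarrow> epoch X U D k \<omega> \<le> t \<and> t < epoch X U D (Suc k) \<omega>"
    by (rule nchanges_eq_iff[OF \<omega>]) (use t in simp)
  show ?thesis
  proof
    assume L: ?L
    then have X1: "X 1 \<omega> = 1" and Xk: "X (Suc k) \<omega> = 0" and n: "nchanges X U D t \<omega> = k"
      using velocity_start[OF \<omega>] r(1) by (auto simp: velocity_def vel_eq_neg_v_iff)
    obtain j where j: "successes k \<omega> = Suc j"
      using successes_pos[OF X1 k] by (cases "successes k \<omega>") auto
    have "j \<in> {..<k}" "k - successes k \<omega> = k - j - 1" "Suc k - successes k \<omega> = k - j"
      using j le by auto
    then show ?R
      using L X1 Xk j pos[OF n Xk] nch n ep'[OF Xk] unfolding ep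
      by (intro bexI[of _ j]) (simp_all del: sum.cl_ivl_Suc epoch.simps)
  next
    assume ?R
    then obtain j where j: "X 1 \<omega> = 1" "successes k \<omega> = Suc j" "X (Suc k) \<omega> = 0"
      "- v * t + (c + v) * (\<Sum>i = 1..j + 1. U i \<omega>) \<in> B"
      "(\<Sum>i = 1..j + 1. U i \<omega>) + (\<Sum>i = 1..k - j - 1. D i \<omega>) \<le> t"
      "t < (\<Sum>i = 1..j + 1. U i \<omega>) + (\<Sum>i = 1..k - j - 1. D i \<omega>) + D (k - j) \<omega>" by blast
    have d: "k - successes k \<omega> = k - j - 1" "Suc k - successes k \<omega> = k - j" using j(2) by auto
    have n: "nchanges X U D t \<omega> = k"
      unfolding nch ep'[OF j(3)] ep d using j by (simp del: sum.cl_ivl_Suc)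
    then show ?L
      using pos[OF n j(3)] j velocity_start[OF \<omega>] vel_eq_neg_v_iff[OF r(1), of k]
      by (simp add: velocity_eq_vel[OF n] del: sum.cl_ivl_Suc)
  qed
qed

section \<open>Mixing over the trials\<close>

abbreviation durations :: "(nat + nat) set" where
  "durations \<equiv> {1..} <+> {1..}"

text \<open>
Forward periods carry the indices \<open>Inl k\<close> and backward periods the indices \<open>Inr k\<close>, so that the
total duration of a block of periods of either kind is a sum over one index set.
\<close>

abbreviation block_sum :: "(nat + nat) set \<Rightarrow> 'a \<Rightarrow> real" where
  "block_sum J \<omega> \<equiv> \<Sum>i\<in>J. case_sum U D i \<omega>"

lemma block_sum_measurable:
  assumes "J \<subseteq> durations" shows "random_variable borel (block_sum J)"
  using assms durations_measurable by (intro borel_measurable_sum) (auto split: sum.splits)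

text \<open>
Both events are preimages of measurable sets under the sequences of trials and of durations, which are
independent of each other.
\<close>

lemma prob_trials_straddle:
  assumes J: "J \<subseteq> durations" "K \<subseteq> durations" "L \<subseteq> durations" and B[measurable]: "B \<in> sets borel"
  shows "\<P>(\<omega> in M. (X 1 \<omega> = 1 \<and> successes k \<omega> = m \<and> X (Suc k) \<omega> = x) \<and>
      \<alpha> + \<beta> * block_sum J \<omega> \<in> B \<and> block_sum J \<omega> + block_sum K \<omega> \<le> t \<and>
      t < block_sum J \<omega> + block_sum K \<omega> + block_sum L \<omega>) =
    \<P>(\<omega> in M. X 1 \<omega> = 1 \<and> successes k \<omega> = m \<and> X (Suc k) \<omega> = x) *
    \<P>(\<omega> in M. \<alpha> + \<beta> * block_sum J \<omega> \<in> B \<and> block_sum J \<omega> + block_sum K \<omega> \<le> t \<and>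
      t < block_sum J \<omega> + block_sum K \<omega> + block_sum L \<omega>)" (is "prob ?GE = prob ?G * prob ?E")
proof -
  let ?XS = "PiM {1::nat..} (\<lambda>_. count_space (UNIV :: nat set))"
  let ?US = "PiM durations (\<lambda>_. borel :: real measure)"
  define xs where "xs \<omega> = (\<lambda>n\<in>{1..}. X n \<omega>)" for \<omega>
  define us where "us \<omega> = (\<lambda>i\<in>durations. case_sum U D i \<omega>)" for \<omega>
  have xs: "xs \<omega> \<in> space ?XS" and us: "us \<omega> \<in> space ?US" for \<omega>
    by (auto simp: xs_def us_def space_PiM)
  define G where "G = {f \<in> space ?XS. f 1 = 1 \<and> (\<Sum>i = 1..k. f i) = m \<and> f (Suc k) = x}"
  define E where "E = {f \<in> space ?US. \<alpha> + \<beta> * (\<Sum>i\<in>J. f i) \<in> B \<and> (\<Sum>i\<in>J. f i) + (\<Sum>i\<in>K. f i) \<le> t \<and>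
      t < (\<Sum>i\<in>J. f i) + (\<Sum>i\<in>K. f i) + (\<Sum>i\<in>L. f i)}"
  have comp: "(\<lambda>f. f i) \<in> measurable ?XS (count_space UNIV)" if "1 \<le> i" for i
    using that by (intro measurable_component_singleton) auto
  have [measurable]: "(\<lambda>f. f 1) \<in> measurable ?XS (count_space UNIV)"
    "(\<lambda>f. f (Suc k)) \<in> measurable ?XS (count_space UNIV)"
    "(\<lambda>f. \<Sum>i = 1..k. f i) \<in> measurable ?XS (count_space UNIV)"
    by (auto intro!: comp measurable_sum_nat)
  have G: "G \<in> sets ?XS" unfolding G_def by measurable
  have sum_meas: "(\<lambda>f. \<Sum>i\<in>S. f i) \<in> borel_measurable ?US" if "S \<subseteq> durations" for S
    using that by (intro borel_measurable_sum measurable_component_singleton) auto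
  note [measurable] = sum_meas[OF J(1)] sum_meas[OF J(2)] sum_meas[OF J(3)]
  have E: "E \<in> sets ?US" unfolding E_def by measurable
  have sum_us: "(\<Sum>i\<in>S. us \<omega> i) = block_sum S \<omega>" if "S \<subseteq> durations" for S \<omega>
    using that by (intro sum.cong) (auto simp: us_def)
  have us_E: "us -` E \<inter> space M = ?E"
    using us J by (auto simp: E_def sum_us)
  have xs_G: "xs -` G \<inter> space M = ?G"
    using xs by (auto simp: G_def) (auto simp: xs_def)
  have "prob (us -` E \<inter> space M \<inter> (xs -` G \<inter> space M)) = prob (us -` E \<inter> space M) * prob (xs -` G \<inter> space M)"
    using UD_X_indep unfolding xs_def[abs_def] us_def[abs_def]
    by (rule indep_setD) (rule in_vimage_algebra[OF E] in_vimage_algebra[OF G])+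
  moreover have "?E \<inter> ?G = ?GE" by auto
  ultimately show ?thesis unfolding us_E xs_G by (simp add: mult.commute)
qed

text \<open>
The step common to both directions of motion. The index \<open>j + 1\<close> counts the successes among the first
\<open>k\<close> trials and \<open>x\<close> is the outcome of the trial that selects the velocity \<open>w\<close> at time \<open>t\<close>. On each of
these disjoint events the position is \<open>\<alpha> + \<beta>\<close> times the sum over block \<open>J j\<close>, and the current period,
block \<open>L j\<close>, starts when the blocks \<open>J j\<close> and \<open>K j\<close> are over.
\<close>

lemma straddle_mixture_density:
  fixes J K L :: "nat \<Rightarrow> (nat + nat) set" and f :: "nat \<Rightarrow> real \<Rightarrow> real" and F :: "real \<Rightarrow> real"
    and t w \<alpha> \<beta> l u :: real and x :: nat
  assumes Js: "finite Js"
    and blocks: "\<And>j. j \<in> Js \<Longrightarrow> J j \<subseteq> durations" "\<And>j. j \<in> Js \<Longrightarrow> K j \<subseteq> durations" "\<And>j. j \<in> Js \<Longrightarrow> L j \<subseteq> durations"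
      "\<And>j. j \<in> Js \<Longrightarrow> J j \<inter> K j = {}" "\<And>j. j \<in> Js \<Longrightarrow> J j \<inter> L j = {}" "\<And>j. j \<in> Js \<Longrightarrow> K j \<inter> L j = {}"
    and f: "\<And>j. j \<in> Js \<Longrightarrow> distributed M lborel (block_sum (J j)) (\<lambda>y. ennreal (f j y))"
      "\<And>j y. j \<in> Js \<Longrightarrow> 0 \<le> f j y"
    and \<beta>: "\<beta> \<noteq> 0"
    and path: "\<And>B \<omega>. B \<subseteq> {l<..<u} \<Longrightarrow> regular_path \<omega> \<Longrightarrow>
      (position c v X U D t \<omega> \<in> B \<and> velocity c v X U D t \<omega> = w \<and> nchanges X U D t \<omega> = k) \<and>
        velocity c v X U D 0 \<omega> = c \<longleftrightarrow>
      (\<exists>j\<in>Js. (X 1 \<omega> = 1 \<and> successes k \<omega> = Suc j \<and> X (Suc k) \<omega> = x) \<and>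
        \<alpha> + \<beta> * block_sum (J j) \<omega> \<in> B \<and> block_sum (J j) \<omega> + block_sum (K j) \<omega> \<le> t \<and>
        t < block_sum (J j) \<omega> + block_sum (K j) \<omega> + block_sum (L j) \<omega>)"
    and F: "\<And>y. y \<in> {l<..<u} \<Longrightarrow> F y = (\<Sum>j\<in>Js.
      \<P>(\<omega> in M. X 1 \<omega> = 1 \<and> successes k \<omega> = Suc j \<and> X (Suc k) \<omega> = x) / \<P>(\<omega> in M. X 1 \<omega> = 1) *
      (f j ((y - \<alpha>) / \<beta>) / \<bar>\<beta>\<bar> * \<P>(\<omega> in M. block_sum (K j) \<omega> \<le> t - (y - \<alpha>) / \<beta> \<and>
         t - (y - \<alpha>) / \<beta> < block_sum (K j) \<omega> + block_sum (L j) \<omega>)))"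
  shows "cond_density_on M (position c v X U D t)
    (\<lambda>\<omega>. velocity c v X U D t \<omega> = w \<and> nchanges X U D t \<omega> = k)
    (\<lambda>\<omega>. velocity c v X U D 0 \<omega> = c) {l<..<u} F"
proof -
  define p where "p j = \<P>(\<omega> in M. X 1 \<omega> = 1 \<and> successes k \<omega> = Suc j \<and> X (Suc k) \<omega> = x)" for j
  define q where "q = \<P>(\<omega> in M. X 1 \<omega> = 1)"
  define h where "h j y = f j ((y - \<alpha>) / \<beta>) / \<bar>\<beta>\<bar> * \<P>(\<omega> in M. block_sum (K j) \<omega> \<le> t - (y - \<alpha>) / \<beta> \<and>
         t - (y - \<alpha>) / \<beta> < block_sum (K j) \<omega> + block_sum (L j) \<omega>)" for j y
  define E where "E B j = {\<omega> \<in> space M. (X 1 \<omega> = 1 \<and> successes k \<omega> = Suc j \<and> X (Suc k) \<omega> = x) \<and>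
        \<alpha> + \<beta> * block_sum (J j) \<omega> \<in> B \<and> block_sum (J j) \<omega> + block_sum (K j) \<omega> \<le> t \<and>
        t < block_sum (J j) \<omega> + block_sum (K j) \<omega> + block_sum (L j) \<omega>}" for B j
  have [measurable]: "X 1 \<in> measurable M (count_space UNIV)" using X_measurable by simp
  have E_meas: "E B j \<in> events" if j: "j \<in> Js" and [measurable]: "B \<in> sets borel" for B j
  proof -
    note [measurable] = block_sum_measurable[OF blocks(1)[OF j]] block_sum_measurable[OF blocks(2)[OF j]]
      block_sum_measurable[OF blocks(3)[OF j]]
    show ?thesis unfolding E_def by measurable
  qed
  have law: "integrable lborel (h j)"
    "B \<in> sets borel \<Longrightarrow> prob (E B j) = p j * (LBINT y:B. h j y)" if j: "j \<in> Js" for j B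
  proof -
    note [measurable] = block_sum_measurable[OF blocks(1)[OF j]] block_sum_measurable[OF blocks(2)[OF j]]
      block_sum_measurable[OF blocks(3)[OF j]]
    have "random_variable (borel \<Otimes>\<^sub>M borel) (\<lambda>\<omega>. (block_sum (K j) \<omega>, block_sum (L j) \<omega>))" by measurable
    note aff = affine_law_straddle[where \<alpha>=\<alpha> and t=t, OF _ this indep_vars_block_sums(1)[OF UD_indep blocks(1)[OF j] blocks(2)[OF j] blocks(3)[OF j] blocks(4)[OF j] blocks(5)[OF j] blocks(6)[OF j]] f(1)[OF j] f(2)[OF j] \<beta>, folded h_def]
    show "integrable lborel (h j)" by (rule aff(1)) measurable
    assume B: "B \<in> sets borel"
    show "prob (E B j) = p j * (LBINT y:B. h j y)"
      unfolding E_def prob_trials_straddle[OF blocks(1)[OF j] blocks(2)[OF j] blocks(3)[OF j] B] p_def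
      by (subst aff(2)[OF _ B]) auto
  qed
  have F_eq: "F y = (\<Sum>j\<in>Js. p j / q * h j y)" if "y \<in> {l<..<u}" for y
    using F[OF that] by (simp add: p_def q_def h_def)
  have int: "set_integrable lborel B (\<lambda>y. p j / q * h j y)" if "j \<in> Js" "B \<in> sets borel" for B j
    using law(1)[OF that(1)] that(2) by (intro integrable_imp_set_integrable integrable_mult_right)
  have int_sum: "set_integrable lborel B (\<lambda>y. \<Sum>j\<in>Js. p j / q * h j y)" if "B \<in> sets borel" for B
    using law(1) that by (intro integrable_imp_set_integrable Bochner_Integration.integrable_sum integrable_mult_right)
  show ?thesis
  proof (rule cond_density_onI)
    have "set_integrable lborel {l<..<u} F \<longleftrightarrow> set_integrable lborel {l<..<u} (\<lambda>y. \<Sum>j\<in>Js. p j / q * h j y)"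
      using F_eq by (intro set_integrable_cong) auto
    then show "set_integrable lborel {l<..<u} F" using int_sum by simp
    fix B :: "real set" assume B[measurable]: "B \<in> sets borel" and sub: "B \<subseteq> {l<..<u}"
    have "prob {\<omega> \<in> space M. (position c v X U D t \<omega> \<in> B \<and> velocity c v X U D t \<omega> = w \<and> nchanges X U D t \<omega> = k) \<and>
        velocity c v X U D 0 \<omega> = c} = prob (\<Union>j\<in>Js. E B j)"
    proof (rule finite_measure_eq_AE)
      show "AE \<omega> in M. (\<omega> \<in> {\<omega> \<in> space M. (position c v X U D t \<omega> \<in> B \<and> velocity c v X U D t \<omega> = w \<and>
          nchanges X U D t \<omega> = k) \<and> velocity c v X U D 0 \<omega> = c}) = (\<omega> \<in> (\<Union>j\<in>Js. E B j))"
        using AE_regular_path AE_space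
      proof eventually_elim
        case (elim \<omega>)
        show ?case using path[OF sub elim(1)] elim(2) unfolding E_def by simp
      qed
      show "(\<Union>j\<in>Js. E B j) \<in> events" using E_meas Js B by (intro sets.finite_UN) auto
    qed measurable
    also have "\<dots> = (\<Sum>j\<in>Js. prob (E B j))"
      using Js E_meas B by (intro finite_measure_finite_Union) (auto simp: disjoint_family_on_def E_def)
    also have "\<dots> = (\<Sum>j\<in>Js. p j * (LBINT y:B. h j y))"
      using law(2)[OF _ B] by (intro sum.cong) auto
    finally have num: "prob {\<omega> \<in> space M. (position c v X U D t \<omega> \<in> B \<and> velocity c v X U D t \<omega> = w \<and> nchanges X U D t \<omega> = k) \<and>
        velocity c v X U D 0 \<omega> = c} = (\<Sum>j\<in>Js. p j * (LBINT y:B. h j y))" .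
    \<comment> \<open>On regular paths the conditioning event is the success of the first trial.\<close>
    have den: "prob {\<omega> \<in> space M. velocity c v X U D 0 \<omega> = c} = q"
      unfolding q_def
    proof (rule prob_eq_AE)
      show "AE \<omega> in M. (velocity c v X U D 0 \<omega> = c) = (X 1 \<omega> = 1)"
        using AE_regular_path by eventually_elim (rule velocity_start)
    qed measurable
    have "(LBINT y:B. F y) = (LBINT y:B. \<Sum>j\<in>Js. p j / q * h j y)"
      using F_eq sub by (intro set_lebesgue_integral_cong) auto
    also have "\<dots> = (\<Sum>j\<in>Js. LBINT y:B. p j / q * h j y)"
      using int B unfolding set_lebesgue_integral_def set_integrable_def
      by (simp add: sum_distrib_left)
    also have "\<dots> = (\<Sum>j\<in>Js. p j * (LBINT y:B. h j y)) / q"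
      by (simp add: sum_divide_distrib)
    finally show "\<P>(\<omega> in M. (position c v X U D t \<omega> \<in> B \<and> velocity c v X U D t \<omega> = w \<and> nchanges X U D t \<omega> = k)
        \<bar> velocity c v X U D 0 \<omega> = c) = (LBINT y:B. F y)"
      unfolding cond_prob_def num den by simp
  qed measurable
qed

lemma block_sum_U: "block_sum (Inl ` {1..n}) \<omega> = (\<Sum>i = 1..n. U i \<omega>)"
  by (subst sum.reindex) (auto simp: inj_on_def)

lemma block_sum_D: "block_sum (Inr ` {1..n}) \<omega> = (\<Sum>i = 1..n. D i \<omega>)"
  by (subst sum.reindex) (auto simp: inj_on_def)

lemma block_sum_nonneg:
  assumes J: "J \<subseteq> durations"
  shows "AE \<omega> in M. 0 \<le> block_sum J \<omega>"
  using AE_regular_path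
proof eventually_elim
  case (elim \<omega>)
  show ?case
  proof (rule sum_nonneg)
    fix i assume "i \<in> J"
    then have "i \<in> durations" using J by blast
    then show "0 \<le> case_sum U D i \<omega>" using regular_pathD(2,3)[OF elim] by auto
  qed
qed

lemma block_subset_durations:
  "Inl ` {1..n} \<subseteq> durations" "Inr ` {1..n} \<subseteq> durations"
  "1 \<le> n \<Longrightarrow> {Inl n} \<subseteq> durations" "1 \<le> n \<Longrightarrow> {Inr n} \<subseteq> durations"
  by (auto simp: Plus_def)

lemma prob_block_straddle:
  assumes K: "K \<subseteq> durations" "L \<subseteq> durations" "K \<inter> L = {}"
    and f: "distributed M lborel (block_sum K) (\<lambda>y. ennreal (f y))" "\<And>y. 0 \<le> f y"
  shows "\<P>(\<omega> in M. block_sum K \<omega> \<le> s \<and> s < block_sum K \<omega> + block_sum L \<omega>) =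
    (LBINT y:{a..a + s}. f (y - a) * tail M (block_sum L) (a + s - y))"
proof -
  have "\<P>(\<omega> in M. block_sum K \<omega> \<le> s \<and> s < block_sum K \<omega> + block_sum L \<omega>) =
    (LBINT q:{0..s}. f q * tail M (block_sum L) (s - q))"
    using indep_vars_block_sums(2)[OF UD_indep, of "{}" K L] K
    by (intro prob_straddle f block_sum_nonneg) auto
  also have "\<dots> = (LBINT y:{a..a + s}. f (y - a) * tail M (block_sum L) (s - (y - a)))"
    by (rule set_integral_shift)
  finally show ?thesis by (simp add: algebra_simps)
qed

lemma cond_density_forward:
  fixes fU fD :: "nat \<Rightarrow> real \<Rightarrow> real" and \<tau> :: "real \<Rightarrow> real \<Rightarrow> real"
  assumes fU_nonneg: "\<And>k x. k \<ge> 1 \<Longrightarrow> fU k x \<ge> 0"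
    and fD_nonneg: "\<And>k x. k \<ge> 1 \<Longrightarrow> fD k x \<ge> 0"
    and fU_density: "\<And>k. k \<ge> 1 \<Longrightarrow> distributed M lborel (\<lambda>\<omega>. \<Sum>i = 1..k. U i \<omega>) (\<lambda>x. ennreal (fU k x))"
    and fD_density: "\<And>k. k \<ge> 1 \<Longrightarrow> distributed M lborel (\<lambda>\<omega>. \<Sum>i = 1..k. D i \<omega>) (\<lambda>x. ennreal (fD k x))"
    and tau: "\<And>x t. \<tau> x t = (v * t + x) / (c + v)"
    and t: "0 < t" and k: "2 \<le> k"
  shows "cond_density_on M (position c v X U D t)
         (\<lambda>\<omega>. velocity c v X U D t \<omega> = c \<and> nchanges X U D t \<omega> = k)
         (\<lambda>\<omega>. velocity c v X U D 0 \<omega> = c)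
         {- v * t <..< c * t}
         (\<lambda>x. 1 / (c + v) *
           (\<Sum>j = 0..k - 2.
              \<P>(\<omega> in M. (nforward c v X (k - 1) \<omega> = j \<and> vel c v X k \<omega> = c) \<bar> vel c v X 0 \<omega> = c)
              * fD (k - j - 1) (t - \<tau> x t)
              * (LBINT s:{t - \<tau> x t .. t}. fU (j + 1) (s - t + \<tau> x t) * tail M (U (j + 2)) (t - s))))"
proof -
  have cv: "0 < c + v" using c_pos v_pos by simp
  have dU: "distributed M lborel (block_sum (Inl ` {1..n})) (\<lambda>y. ennreal (fU n y))" if "1 \<le> n" for n
    using fU_density[OF that] unfolding block_sum_U .
  have dD: "distributed M lborel (block_sum (Inr ` {1..n})) (\<lambda>y. ennreal (fD n y))" if "1 \<le> n" for n
    using fD_density[OF that] unfolding block_sum_D .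
  have k1: "1 \<le> k" using k by simp
  have ix: "{0..k - 2} = {..<k - 1}" using k by auto
  show ?thesis
  proof (rule straddle_mixture_density[where Js="{..<k - 1}" and x=1 and \<alpha>="c * t" and \<beta>="- (c + v)"
        and J="\<lambda>j. Inr ` {1..k - j - 1}" and K="\<lambda>j. Inl ` {1..j + 1}" and L="\<lambda>j. {Inl (j + 2)}"
        and f="\<lambda>j. fD (k - j - 1)"], goal_cases)
    \<comment> \<open>The event on regular paths.\<close>
    case (11 B \<omega>)
    show ?case using forward_path_iff[OF 11(2) t k1 11(1)] unfolding block_sum_U block_sum_D by simp
  next
    \<comment> \<open>The value of the mixture density at an interior point.\<close>
    case (12 y)
    have abs: "\<bar>- (c + v)\<bar> = c + v" "\<bar>c + v\<bar> = c + v" using cv by simp_all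
    have y: "(y - c * t) / - (c + v) = t - \<tau> y t" "t - (t - \<tau> y t) = \<tau> y t"
      using cv by (auto simp: tau field_simps)
    have "\<P>(\<omega> in M. block_sum (Inl ` {1..j + 1}) \<omega> \<le> \<tau> y t \<and>
        \<tau> y t < block_sum (Inl ` {1..j + 1}) \<omega> + block_sum {Inl (j + 2)} \<omega>) =
      (LBINT s:{t - \<tau> y t .. t}. fU (j + 1) (s - t + \<tau> y t) * tail M (U (j + 2)) (t - s))" for j
    proof -
      have "Inl ` {1..j + 1} \<inter> {Inl (j + 2)} = ({} :: (nat + nat) set)" by auto
      from prob_block_straddle[OF block_subset_durations(1) block_subset_durations(3) this dU fU_nonneg,
          of "\<tau> y t" "t - \<tau> y t"]
      show ?thesis by (simp add: diff_add_eq diff_diff_eq2)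
    qed
    then show ?case
      unfolding y abs ix cond_prob_forward[OF k1] by (simp add: sum_distrib_left mult_ac)
  next
    case (2 j) show ?case by (rule block_subset_durations)
  next
    case (3 j) show ?case by (rule block_subset_durations)
  next
    case (4 j) show ?case by (rule block_subset_durations) simp
  next
    case (8 j) then show ?case using dD[of "k - j - 1"] by simp
  next
    case (9 j) then show ?case using fD_nonneg[of "k - j - 1"] by simp
  qed (use cv in auto)
qed

text \<open>
Compared with forward motion there is one more index, \<open>j = k - 1\<close>. Its middle block is empty, and
the factor of the density is the tail of the first backward period.
\<close>

lemma cond_density_backward:
  fixes fU fD :: "nat \<Rightarrow> real \<Rightarrow> real" and \<tau> :: "real \<Rightarrow> real \<Rightarrow> real"
  assumes fU_nonneg: "\<And>k x. k \<ge> 1 \<Longrightarrow> fU k x \<ge> 0"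
    and fD_nonneg: "\<And>k x. k \<ge> 1 \<Longrightarrow> fD k x \<ge> 0"
    and fU_density: "\<And>k. k \<ge> 1 \<Longrightarrow> distributed M lborel (\<lambda>\<omega>. \<Sum>i = 1..k. U i \<omega>) (\<lambda>x. ennreal (fU k x))"
    and fD_density: "\<And>k. k \<ge> 1 \<Longrightarrow> distributed M lborel (\<lambda>\<omega>. \<Sum>i = 1..k. D i \<omega>) (\<lambda>x. ennreal (fD k x))"
    and tau: "\<And>x t. \<tau> x t = (v * t + x) / (c + v)"
    and t: "0 < t" and k1: "1 \<le> k"
  shows "cond_density_on M (position c v X U D t)
         (\<lambda>\<omega>. velocity c v X U D t \<omega> = - v \<and> nchanges X U D t \<omega> = k)
         (\<lambda>\<omega>. velocity c v X U D 0 \<omega> = c)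
         {- v * t <..< c * t}
         (\<lambda>x. 1 / (c + v) *
           (\<P>(\<omega> in M. (nforward c v X (k - 1) \<omega> = k - 1 \<and> vel c v X k \<omega> = - v) \<bar> vel c v X 0 \<omega> = c)
              * fU k (\<tau> x t) * tail M (D 1) (t - \<tau> x t)
            + (if k \<ge> 2 then
                (\<Sum>j = 0..k - 2.
                  \<P>(\<omega> in M. (nforward c v X (k - 1) \<omega> = j \<and> vel c v X k \<omega> = - v) \<bar> vel c v X 0 \<omega> = c)
                  * fU (j + 1) (\<tau> x t)
                  * (LBINT s:{\<tau> x t .. t}. fD (k - j - 1) (s - \<tau> x t) * tail M (D (k - j)) (t - s)))
               else 0)))"
proof -
  have cv: "0 < c + v" using c_pos v_pos by simp
  have dU: "distributed M lborel (block_sum (Inl ` {1..n})) (\<lambda>y. ennreal (fU n y))" if "1 \<le> n" for n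
    using fU_density[OF that] unfolding block_sum_U .
  have dD: "distributed M lborel (block_sum (Inr ` {1..n})) (\<lambda>y. ennreal (fD n y))" if "1 \<le> n" for n
    using fD_density[OF that] unfolding block_sum_D .
  show ?thesis
  proof (rule straddle_mixture_density[where Js="{..<k}" and x=0 and \<alpha>="- v * t" and \<beta>="c + v"
        and J="\<lambda>j. Inl ` {1..j + 1}" and K="\<lambda>j. Inr ` {1..k - j - 1}" and L="\<lambda>j. {Inr (k - j)}"
        and f="\<lambda>j. fU (j + 1)"], goal_cases)
    \<comment> \<open>The event on regular paths.\<close>
    case (11 B \<omega>)
    show ?case using backward_path_iff[OF 11(2) t k1] unfolding block_sum_U block_sum_D by simp
  next
    \<comment> \<open>The value of the mixture density at an interior point.\<close>
    case (12 y)
    have abs: "\<bar>- (c + v)\<bar> = c + v" "\<bar>c + v\<bar> = c + v" using cv by simp_all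
    have y: "(y - - v * t) / (c + v) = \<tau> y t"
      using cv by (simp add: tau field_simps)
    have le: "0 \<le> t - \<tau> y t" using 12 cv by (simp add: tau field_simps)
    define Q where "Q j = \<P>(\<omega> in M. block_sum (Inr ` {1..k - j - 1}) \<omega> \<le> t - \<tau> y t \<and>
        t - \<tau> y t < block_sum (Inr ` {1..k - j - 1}) \<omega> + block_sum {Inr (k - j)} \<omega>)" for j
    \<comment> \<open>For \<open>j = k - 1\<close> the block of completed backward periods is empty.\<close>
    have Q_last: "Q (k - 1) = tail M (D 1) (t - \<tau> y t)"
      using le k1 by (simp add: Q_def tail_def)
    have Q_less: "Q j = (LBINT s:{\<tau> y t .. t}. fD (k - j - 1) (s - \<tau> y t) * tail M (D (k - j)) (t - s))"
      if "j < k - 1" for j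
    proof -
      have kj: "1 \<le> k - j" "1 \<le> k - j - 1" using that by auto
      then have "Inr ` {1..k - j - 1} \<inter> {Inr (k - j)} = ({} :: (nat + nat) set)" by auto
      from prob_block_straddle[OF block_subset_durations(2) block_subset_durations(4)[OF kj(1)] this
          dD[OF kj(2)] fD_nonneg[OF kj(2)], of "t - \<tau> y t" "\<tau> y t"]
      show ?thesis by (simp add: Q_def)
    qed
    define p where "p j = \<P>(\<omega> in M. X 1 \<omega> = 1 \<and> successes k \<omega> = Suc j \<and> X (Suc k) \<omega> = 0) / \<P>(\<omega> in M. X 1 \<omega> = 1)" for j
    have "{..<k} = insert (k - 1) {..<k - 1}" using k1 by auto
    then have "(\<Sum>j<k. p j * (fU (j + 1) (\<tau> y t) / (c + v) * Q j)) =
        p (k - 1) * (fU k (\<tau> y t) / (c + v) * Q (k - 1)) +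
        (\<Sum>j<k - 1. p j * (fU (j + 1) (\<tau> y t) / (c + v) * Q j))"
      using k1 by simp
    also have "(\<Sum>j<k - 1. p j * (fU (j + 1) (\<tau> y t) / (c + v) * Q j)) =
        1 / (c + v) * (if k \<ge> 2 then (\<Sum>j = 0..k - 2. p j * fU (j + 1) (\<tau> y t) *
          (LBINT s:{\<tau> y t .. t}. fD (k - j - 1) (s - \<tau> y t) * tail M (D (k - j)) (t - s))) else 0)"
    proof (cases "k \<ge> 2")
      case True
      then have "{0..k - 2} = {..<k - 1}" by auto
      then show ?thesis using True Q_less cv by (simp add: sum_distrib_left mult_ac)
    next
      case False
      then show ?thesis using k1 by simp
    qed
    finally show ?case
      unfolding y abs cond_prob_backward[OF k1] p_def[symmetric] Q_def[symmetric] Q_last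
      using cv by (simp add: distrib_left mult_ac)
  next
    case (2 j) show ?case by (rule block_subset_durations)
  next
    case (3 j) show ?case by (rule block_subset_durations)
  next
    case (4 j) then show ?case by (intro block_subset_durations) simp
  next
    case (8 j) then show ?case using dU[of "j + 1"] by simp
  next
    case (9 j) then show ?case using fU_nonneg[of "j + 1"] by simp
  qed (use cv in auto)
qed

end

theorem theorem3p1:
  fixes M :: "'a measure"
    and c v b r A :: real
    and X :: "nat \<Rightarrow> 'a \<Rightarrow> nat"
    and U D :: "nat \<Rightarrow> 'a \<Rightarrow> real"
    and fU fD :: "nat \<Rightarrow> real \<Rightarrow> real"
    and \<tau> :: "real \<Rightarrow> real \<Rightarrow> real"
  assumes model: "trial_telegraph M c v b r A X U D"
    and fU_nonneg: "\<And>k x. k \<ge> 1 \<Longrightarrow> fU k x \<ge> 0"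
    and fD_nonneg: "\<And>k x. k \<ge> 1 \<Longrightarrow> fD k x \<ge> 0"
    and fU_density: "\<And>k. k \<ge> 1 \<Longrightarrow> distributed M lborel (\<lambda>\<omega>. \<Sum>i = 1..k. U i \<omega>) (\<lambda>x. ennreal (fU k x))"
    and fD_density: "\<And>k. k \<ge> 1 \<Longrightarrow> distributed M lborel (\<lambda>\<omega>. \<Sum>i = 1..k. D i \<omega>) (\<lambda>x. ennreal (fD k x))"
    and tau: "\<And>x t. \<tau> x t = (v * t + x) / (c + v)"
  shows
    "(\<forall>t > 0. \<forall>k \<ge> 2.
       cond_density_on M (position c v X U D t)
         (\<lambda>\<omega>. velocity c v X U D t \<omega> = c \<and> nchanges X U D t \<omega> = k)
         (\<lambda>\<omega>. velocity c v X U D 0 \<omega> = c)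
         {- v * t <..< c * t}
         (\<lambda>x. 1 / (c + v) *
           (\<Sum>j = 0..k - 2.
              \<P>(\<omega> in M. (nforward c v X (k - 1) \<omega> = j \<and> vel c v X k \<omega> = c) \<bar> vel c v X 0 \<omega> = c)
              * fD (k - j - 1) (t - \<tau> x t)
              * (LBINT s:{t - \<tau> x t .. t}. fU (j + 1) (s - t + \<tau> x t) * tail M (U (j + 2)) (t - s)))))
   \<and> (\<forall>t > 0. \<forall>k \<ge> 1.
       cond_density_on M (position c v X U D t)
         (\<lambda>\<omega>. velocity c v X U D t \<omega> = - v \<and> nchanges X U D t \<omega> = k)
         (\<lambda>\<omega>. velocity c v X U D 0 \<omega> = c)
         {- v * t <..< c * t}
         (\<lambda>x. 1 / (c + v) *
           (\<P>(\<omega> in M. (nforward c v X (k - 1) \<omega> = k - 1 \<and> vel c v X k \<omega> = - v) \<bar> vel c v X 0 \<omega> = c)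
              * fU k (\<tau> x t) * tail M (D 1) (t - \<tau> x t)
            + (if k \<ge> 2 then
                (\<Sum>j = 0..k - 2.
                  \<P>(\<omega> in M. (nforward c v X (k - 1) \<omega> = j \<and> vel c v X k \<omega> = - v) \<bar> vel c v X 0 \<omega> = c)
                  * fU (j + 1) (\<tau> x t)
                  * (LBINT s:{\<tau> x t .. t}. fD (k - j - 1) (s - \<tau> x t) * tail M (D (k - j)) (t - s)))
               else 0))))
   \<and> (\<forall>k \<ge> 1. \<forall>j \<le> k - 1.
       (A = 0 \<longrightarrow> (let p = b / (b + r) in
          \<P>(\<omega> in M. (nforward c v X (k - 1) \<omega> = j \<and> vel c v X k \<omega> = c) \<bar> vel c v X 0 \<omega> = c)
            = real ((k - 1) choose j) * p ^ (j + 1) * (1 - p) ^ (k - 1 - j)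
        \<and> \<P>(\<omega> in M. (nforward c v X (k - 1) \<omega> = j \<and> vel c v X k \<omega> = - v) \<bar> vel c v X 0 \<omega> = c)
            = real ((k - 1) choose j) * p ^ j * (1 - p) ^ (k - j))) \<and>
       (A > 0 \<longrightarrow>
          \<P>(\<omega> in M. (nforward c v X (k - 1) \<omega> = j \<and> vel c v X k \<omega> = c) \<bar> vel c v X 0 \<omega> = c)
            = real ((k - 1) choose j) * (pochhammer ((b + A) / A) (j + 1) * pochhammer (r / A) (k - j - 1)
                / pochhammer ((b + A + r) / A) k)
        \<and> \<P>(\<omega> in M. (nforward c v X (k - 1) \<omega> = j \<and> vel c v X k \<omega> = - v) \<bar> vel c v X 0 \<omega> = c)
            = real ((k - 1) choose j) * (pochhammer ((b + A) / A) j * pochhammer (r / A) (k - j)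
                / pochhammer ((b + A + r) / A) k)))"
proof -
  interpret trial_telegraph M c v b r A X U D by (rule model)
  note densities = fU_nonneg fD_nonneg fU_density fD_density tau
  show ?thesis
    by (intro conjI allI impI cond_density_forward[OF densities] cond_density_backward[OF densities]
        cond_prob_bernoulli cond_prob_polya)
qed

end
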